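(* Let $X$ be a complex Banach space and $T\in\mathcal{B}(X)$. The following statements are equivalent: 1) $\sigma_{uf}(T)=\sigma_{uB}(T)$; 2) $T$ has SVEP at every $\lambda\notin\sigma_{uf}(T)$; 3) $T$ has SVEP at every $\lambda\notin\sigma_{puBF}(T)$; 4) $\sigma_{gD\mathcal{M}}(T)=\sigma_{puBF}(T)$.
   Context: $\mathcal{B}(X)$ is the algebra of bounded linear operators on $X$; $N(T)$, $R(T)$ are kernel and range. $(M,N)\in Red(T)$ means that $M,N$ are closed $T$-invariant subspaces with $X=M\oplus N$. $T$ is upper semi-Fredholm if $\dim N(T)<\infty$ and $R(T)$ is closed. The ascent is $a(T)=\min\{p: N(T^p)=N(T^{p+1})\}$ ($\infty$ if no such $p$). $T$ is upper semi-Browder if it is upper semi-Fredholm with $a(T)<\infty$. $T$ is pseudo upper B-Fredholm (resp. generalized Drazin bounded below) if there exists $(M,N)\in Red(T)$ such that $T_{|M}$ is upper semi-Fredholm (resp. bounded below) and $T_{|N}$ is quasi-nilpotent. The sets of $\lambda\in\mathbb{C}$ such that $T-\lambda I$ is not upper semi-Fredholm, upper semi-Browder, pseudo upper B-Fredholm, generalized Drazin bounded below are denoted $\sigma_{uf}(T)$, $\sigma_{uB}(T)$, $\sigma_{puBF}(T)$, $\sigma_{gD\mathcal{M}}(T)$, respectively. $T$ has SVEP (the single valued extension property) at $\lambda_0\in\mathbb{C}$ if for every connected open neighbourhood $U$ of $\lambda_0$ the only analytic function $f:U\to X$ with $(T-zI)f(z)=0$ for all $z\in U$ is $f\equiv 0$.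 *)

theory Defs
  imports "HOL-Analysis.Analysis"
begin

section \<open>Complex Banach spaces\<close>

class complex_normed_vector = real_normed_vector +
  fixes scaleC :: "complex \<Rightarrow> 'a \<Rightarrow> 'a" (infixr \<open>*\<^sub>C\<close> 75)
  assumes scaleC_add_right: "a *\<^sub>C (x + y) = a *\<^sub>C x + a *\<^sub>C y"
    and scaleC_add_left: "(a + b) *\<^sub>C x = a *\<^sub>C x + b *\<^sub>C x"
    and scaleC_scaleC: "a *\<^sub>C (b *\<^sub>C x) = (a * b) *\<^sub>C x"
    and scaleC_of_real: "complex_of_real r *\<^sub>C x = r *\<^sub>R x"
    and norm_scaleC: "norm (a *\<^sub>C x) = cmod a * norm x"

class complex_banach = complex_normed_vector + banach

instantiation complex :: complex_banach
begin

definition scaleC_complex :: "complex \<Rightarrow> complex \<Rightarrow> complex" where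
  "scaleC_complex a x = a * x"

instance
  by standard (simp_all add: scaleC_complex_def algebra_simps norm_mult scaleR_conv_of_real)

end

global_interpretation complex_vector: vector_space "scaleC :: complex \<Rightarrow> 'a \<Rightarrow> 'a::complex_normed_vector"
  defines csubspace = complex_vector.subspace
    and cspan = complex_vector.span
proof
  show "1 *\<^sub>C x = x" for x :: 'a
    using scaleC_of_real [of 1 x] by simp
qed (simp_all add: scaleC_add_right scaleC_add_left scaleC_scaleC)


section \<open>Operators on subspaces\<close>

text \<open>
  The restriction of an operator to an invariant subspace \<open>M\<close> is represented by the operator itself
  together with the set \<open>M\<close>: all the notions below carry the subspace as a parameter and only
  look at the values of the operator on \<open>M\<close>. Taking \<open>M = UNIV\<close> gives the notion on the whole space.
\<close>

definition bounded_clinear_on ::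
    "'a::complex_normed_vector set \<Rightarrow> ('a \<Rightarrow> 'a) \<Rightarrow> bool" where
  "bounded_clinear_on M T \<longleftrightarrow>
     T ` M \<subseteq> M \<and>
     (\<forall>x\<in>M. \<forall>y\<in>M. T (x + y) = T x + T y) \<and>
     (\<forall>c. \<forall>x\<in>M. T (c *\<^sub>C x) = c *\<^sub>C T x) \<and>
     (\<exists>K. \<forall>x\<in>M. norm (T x) \<le> norm x * K)"

abbreviation bounded_clinear :: "('a::complex_normed_vector \<Rightarrow> 'a) \<Rightarrow> bool" where
  "bounded_clinear \<equiv> bounded_clinear_on UNIV"

lemma bounded_clinear_iff:
  "bounded_clinear T \<longleftrightarrow> bounded_linear T \<and> (\<forall>c x. T (c *\<^sub>C x) = c *\<^sub>C T x)"
proof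
  assume *: "bounded_clinear T"
  have "T (r *\<^sub>R x) = r *\<^sub>R T x" for r x
    using * by (simp add: bounded_clinear_on_def flip: scaleC_of_real)
  with * show "bounded_linear T \<and> (\<forall>c x. T (c *\<^sub>C x) = c *\<^sub>C T x)"
    by (auto simp: bounded_clinear_on_def bounded_linear_def linear_iff bounded_linear_axioms_def)
next
  assume "bounded_linear T \<and> (\<forall>c x. T (c *\<^sub>C x) = c *\<^sub>C T x)"
  then show "bounded_clinear T"
    by (auto simp: bounded_clinear_on_def bounded_linear_def linear_iff bounded_linear_axioms_def)
qed

definition shift_op :: "('a::complex_normed_vector \<Rightarrow> 'a) \<Rightarrow> complex \<Rightarrow> 'a \<Rightarrow> 'a" where
  "shift_op T z = (\<lambda>x. T x - z *\<^sub>C x)"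

definition kernel_on :: "'a::zero set \<Rightarrow> ('a \<Rightarrow> 'a) \<Rightarrow> 'a set" where
  "kernel_on M T = {x\<in>M. T x = 0}"

definition finite_cdim :: "'a::complex_normed_vector set \<Rightarrow> bool" where
  "finite_cdim V \<longleftrightarrow> (\<exists>B. finite B \<and> V \<subseteq> cspan B)"

text \<open>For closed \<open>M\<close>, a subset of \<open>M\<close> is closed in \<open>M\<close> iff it is closed in the whole space.\<close>

definition upper_semi_Fredholm_on ::
    "'a::complex_normed_vector set \<Rightarrow> ('a \<Rightarrow> 'a) \<Rightarrow> bool" where
  "upper_semi_Fredholm_on M T \<longleftrightarrow> finite_cdim (kernel_on M T) \<and> closed (T ` M)"

definition bounded_below_on ::
    "'a::complex_normed_vector set \<Rightarrow> ('a \<Rightarrow> 'a) \<Rightarrow> bool" where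
  "bounded_below_on M T \<longleftrightarrow> (\<exists>c>0. \<forall>x\<in>M. c * norm x \<le> norm (T x))"

definition invertible_on ::
    "'a::complex_normed_vector set \<Rightarrow> ('a \<Rightarrow> 'a) \<Rightarrow> bool" where
  "invertible_on M T \<longleftrightarrow>
     (\<exists>S. bounded_clinear_on M S \<and> (\<forall>x\<in>M. S (T x) = x \<and> T (S x) = x))"

definition spectrum_on ::
    "'a::complex_normed_vector set \<Rightarrow> ('a \<Rightarrow> 'a) \<Rightarrow> complex set" where
  "spectrum_on M T = {z. \<not> invertible_on M (shift_op T z)}"

text \<open>Inclusion rather than equality, because the spectrum on the zero space is empty.\<close>

definition quasi_nilpotent_on ::
    "'a::complex_normed_vector set \<Rightarrow> ('a \<Rightarrow> 'a) \<Rightarrow> bool" where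
  "quasi_nilpotent_on M T \<longleftrightarrow> spectrum_on M T \<subseteq> {0}"

definition Red :: "('a::complex_normed_vector \<Rightarrow> 'a) \<Rightarrow> ('a set \<times> 'a set) set" where
  "Red T = {(M, N).
     csubspace M \<and> closed M \<and> T ` M \<subseteq> M \<and>
     csubspace N \<and> closed N \<and> T ` N \<subseteq> N \<and>
     {x + y | x y. x \<in> M \<and> y \<in> N} = UNIV \<and> M \<inter> N = {0}}"


section \<open>Classes of operators and their spectra\<close>

text \<open>In \<^typ>\<open>enat\<close>, the infimum of the empty set is \<open>\<infinity>\<close>.\<close>

definition ascent :: "('a::zero \<Rightarrow> 'a) \<Rightarrow> enat" where
  "ascent T = Inf (enat ` {p. kernel_on UNIV (T ^^ p) = kernel_on UNIV (T ^^ (p + 1))})"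

definition upper_semi_Fredholm :: "('a::complex_normed_vector \<Rightarrow> 'a) \<Rightarrow> bool" where
  "upper_semi_Fredholm T \<longleftrightarrow> upper_semi_Fredholm_on UNIV T"

definition upper_semi_Browder :: "('a::complex_normed_vector \<Rightarrow> 'a) \<Rightarrow> bool" where
  "upper_semi_Browder T \<longleftrightarrow> upper_semi_Fredholm T \<and> ascent T < \<infinity>"

definition pseudo_upper_B_Fredholm :: "('a::complex_normed_vector \<Rightarrow> 'a) \<Rightarrow> bool" where
  "pseudo_upper_B_Fredholm T \<longleftrightarrow>
     (\<exists>(M, N) \<in> Red T. upper_semi_Fredholm_on M T \<and> quasi_nilpotent_on N T)"

definition gen_Drazin_bounded_below :: "('a::complex_normed_vector \<Rightarrow> 'a) \<Rightarrow> bool" where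
  "gen_Drazin_bounded_below T \<longleftrightarrow>
     (\<exists>(M, N) \<in> Red T. bounded_below_on M T \<and> quasi_nilpotent_on N T)"

definition sigma_uf :: "('a::complex_normed_vector \<Rightarrow> 'a) \<Rightarrow> complex set" where
  "sigma_uf T = {z. \<not> upper_semi_Fredholm (shift_op T z)}"

definition sigma_uB :: "('a::complex_normed_vector \<Rightarrow> 'a) \<Rightarrow> complex set" where
  "sigma_uB T = {z. \<not> upper_semi_Browder (shift_op T z)}"

definition sigma_puBF :: "('a::complex_normed_vector \<Rightarrow> 'a) \<Rightarrow> complex set" where
  "sigma_puBF T = {z. \<not> pseudo_upper_B_Fredholm (shift_op T z)}"

definition sigma_gDM :: "('a::complex_normed_vector \<Rightarrow> 'a) \<Rightarrow> complex set" where
  "sigma_gDM T = {z. \<not> gen_Drazin_bounded_below (shift_op T z)}"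


section \<open>The single valued extension property\<close>

text \<open>
  Vector-valued analyticity on an open set is complex differentiability at every point: the
  derivative is the complex-linear map given by a vector. The library notions
  \<^const>\<open>holomorphic_on\<close> and \<^const>\<open>analytic_on\<close> are confined to values in a normed field.
\<close>

definition vector_analytic_on ::
    "(complex \<Rightarrow> 'a::complex_normed_vector) \<Rightarrow> complex set \<Rightarrow> bool" where
  "vector_analytic_on f U \<longleftrightarrow> (\<forall>z\<in>U. \<exists>d. (f has_derivative (\<lambda>h. h *\<^sub>C d)) (at z))"

definition SVEP_at :: "('a::complex_normed_vector \<Rightarrow> 'a) \<Rightarrow> complex \<Rightarrow> bool" where
  "SVEP_at T z0 \<longleftrightarrow>
     (\<forall>U. open U \<and> connected U \<and> z0 \<in> U \<longrightarrow>
       (\<forall>f. vector_analytic_on f U \<and> (\<forall>z\<in>U. shift_op T z (f z) = 0) \<longrightarrow> (\<forall>z\<in>U. f z = 0)))"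

end

theory Submission
  imports Defs "HOL-Complex_Analysis.Conformal_Mappings"
begin

text \<open>
  Write \<open>S\<close> for a shift \<open>T - z\<close>. The theorem rests on one structural fact about an upper semi-Fredholm
  operator \<open>S\<close> on a closed invariant subspace \<open>M\<close>, whose hyperrange is the intersection of the
  ranges of its powers. The following are equivalent: the kernel meets the hyperrange only in 0; and
  \<open>M\<close> splits into closed invariant subspaces on which \<open>S\<close> is bounded below and nilpotent.

  The splitting is built one Jordan block at a time (\<open>Jordan_block_splits_off\<close>,
  \<open>upper_semi_Fredholm_nilpotent_splitting\<close>): a kernel vector outside the hyperrange is the end of a
  Jordan block, and a functional that separates it from the next range cuts out an invariant
  complement. If on the other hand a nonzero kernel vector \<open>x\<close> lies in the hyperrange, then \<open>S\<close> maps
  the hyperrange onto itself, and the open mapping theorem produces a backward orbit: a sequence \<open>y\<close>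
  of at most geometric growth with \<open>y 0 = x\<close> and \<open>S (y (n + 1)) = y n\<close>. The power series with these
  coefficients is an analytic family of eigenvectors, so the single valued extension property fails
  (\<open>SVEP_imp_kernel_hyperrange_trivial\<close>).

  Thus the extension property and upper semi-Fredholmness together give the splitting, from which
  finite ascent can be read off. The quasi-nilpotent summand of a pseudo upper B-Fredholm operator
  absorbs the nilpotent part, which leaves a generalized Drazin bounded below operator. In the other
  direction, a generalized Drazin bounded below operator is injective at all small nonzero shifts,
  and the identity theorem for analytic functions turns this into the extension property. Finite
  ascent leads back to the same situation, as it also keeps kernel vectors out of the hyperrange.

  The second and third conditions are linked by perturbation: near a point where \<open>T - z\<close> is pseudo
  upper B-Fredholm, all other shifts are upper semi-Fredholm, since the semi-Fredholm summand is
  stable and the quasi-nilpotent one becomes invertible (\<open>pseudo_upper_B_Fredholm_punctured\<close>).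

  The functional analysis behind this consists of the Hahn-Banach theorem, which provides the
  functionals, closed complements and the scalar form of the identity theorem, and of the open
  mapping theorem for operators with closed image.
\<close>

section \<open>The Hahn-Banach theorem\<close>

definition sublinear :: "('a::real_vector \<Rightarrow> real) \<Rightarrow> bool" where
  "sublinear p \<longleftrightarrow> (\<forall>x y. p (x + y) \<le> p x + p y) \<and> (\<forall>t\<ge>0. \<forall>x. p (t *\<^sub>R x) = t * p x)"

lemma sublinearI:
  assumes "\<And>x y. p (x + y) \<le> p x + p y" and "p 0 = 0"
    and le: "\<And>t x. t > 0 \<Longrightarrow> p (t *\<^sub>R x) \<le> t * p x"
  shows "sublinear p"
proof -
  have "p (t *\<^sub>R x) = t * p x" if "t \<ge> 0" for t x
  proof (cases "t = 0")
    case False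
    with that have t: "t > 0" by simp
    have "p ((1/t) *\<^sub>R (t *\<^sub>R x)) \<le> (1/t) * p (t *\<^sub>R x)"
      using t by (intro le) simp
    then have "t * p x \<le> p (t *\<^sub>R x)"
      using t by (simp add: field_simps)
    with le[OF t, of x] show ?thesis by simp
  qed (use assms in auto)
  then show ?thesis using assms by (simp add: sublinear_def)
qed

lemma sublinear_lower_bound:
  assumes "sublinear p"
  shows "- p (- x) \<le> p x" "p 0 = 0"
proof -
  have *: "p (0 *\<^sub>R x) = 0 * p x" for x using assms unfolding sublinear_def by blast
  then show "p 0 = 0" by simp
  have "p (x + - x) \<le> p x + p (- x)" using assms unfolding sublinear_def by blast
  then show "- p (- x) \<le> p x" using \<open>p 0 = 0\<close> by simp
qed

text \<open>
  Sending \<open>y\<close> to the infimum of \<open>p (y + t x0) - t p x0\<close> over \<open>t \<ge> 0\<close> lowers a sublinear functional as far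
  as possible in the direction \<open>- x0\<close>, and keeps it sublinear. This one step does double duty: it
  prescribes the value of the Hahn-Banach functional at \<open>x0\<close>, and it shows that a sublinear functional
  that cannot be lowered any further is odd, hence linear.
\<close>
lemma sublinear_lower_along:
  assumes p: "sublinear p"
  obtains q where "sublinear q" "\<And>x. q x \<le> p x" "q (- x0) \<le> - p x0"
proof -
  define h where "h y t = p (y + t *\<^sub>R x0) - t * p x0" for y t
  define q where "q y = (INF t\<in>{0..}. h y t)" for y
  have add: "p (x + y) \<le> p x + p y" and hom: "t \<ge> 0 \<Longrightarrow> p (t *\<^sub>R x) = t * p x" for x y t
    using p by (auto simp: sublinear_def)
  have low: "- p (- y) \<le> h y t" if "t \<ge> 0" for y t
    using add[of "y + t *\<^sub>R x0" "- y"] hom[OF that, of x0] by (simp add: h_def)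
  have bdd: "bdd_below (h y ` {0..})" for y
    by (rule bdd_belowI2[of _ "- p (- y)"]) (use low in auto)
  have le: "q y \<le> h y t" if "t \<ge> 0" for y t
    unfolding q_def by (rule cINF_lower[OF bdd]) (use that in auto)
  have ge: "c \<le> q y" if "\<And>t. t \<ge> 0 \<Longrightarrow> c \<le> h y t" for c y
    unfolding q_def by (rule cINF_greatest) (use that in auto)
  have "sublinear q"
  proof (rule sublinearI)
    fix x y
    have *: "q (x + y) \<le> h x s + h y t" if "s \<ge> 0" "t \<ge> 0" for s t
    proof -
      have "q (x + y) \<le> h (x + y) (s + t)" using that by (intro le) simp
      also have "\<dots> \<le> h x s + h y t"
        using add[of "x + s *\<^sub>R x0" "y + t *\<^sub>R x0"] by (simp add: h_def algebra_simps)
      finally show ?thesis .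
    qed
    have "q (x + y) - h y t \<le> q x" if "t \<ge> 0" for t
      by (rule ge) (use *[OF _ that] in \<open>simp add: algebra_simps\<close>)
    then have "q (x + y) - q x \<le> q y"
      by (intro ge) (simp add: algebra_simps)
    then show "q (x + y) \<le> q x + q y" by simp
  next
    have "h 0 0 = 0" using sublinear_lower_bound[OF p] by (simp add: h_def)
    moreover have "0 \<le> q 0" by (rule ge) (use low[of _ 0] sublinear_lower_bound[OF p] in auto)
    ultimately show "q 0 = 0" using le[of 0 0] by simp
  next
    fix t :: real and x assume t: "t > 0"
    have "q (t *\<^sub>R x) / t \<le> q x"
    proof (rule ge)
      fix s :: real assume s: "s \<ge> 0"
      have "q (t *\<^sub>R x) \<le> h (t *\<^sub>R x) (t * s)" using s t by (intro le) simp
      also have "\<dots> = t * h x s"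
        using hom[of t "x + s *\<^sub>R x0"] t by (simp add: h_def algebra_simps)
      finally show "q (t *\<^sub>R x) / t \<le> h x s" using t by (simp add: field_simps)
    qed
    then show "q (t *\<^sub>R x) \<le> t * q x" using t by (simp add: field_simps)
  qed
  moreover have "q x \<le> p x" for x using le[of 0 x] by (simp add: h_def)
  moreover have "q (- x0) \<le> - p x0"
    using le[of 1 "- x0"] sublinear_lower_bound[OF p] by (simp add: h_def)
  ultimately show ?thesis using that by blast
qed

text \<open>
  Zorn's lemma applies because along a chain the pointwise infimum is again sublinear: of two members
  of the chain the smaller one serves both summands. The infimum is finite, since every sublinear
  \<open>q \<le> p\<close> satisfies \<open>q x \<ge> - p (- x)\<close>.
\<close>
lemma sublinear_minimal_below:
  assumes p: "sublinear (p :: 'a::real_vector \<Rightarrow> real)"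
  obtains m where "sublinear m" "\<And>x. m x \<le> p x"
    "\<And>q. sublinear q \<Longrightarrow> (\<And>x. q x \<le> m x) \<Longrightarrow> q = m"
proof -
  define A where "A = {q. sublinear q \<and> q \<le> p}"
  have "\<exists>m\<in>A. \<forall>a\<in>A. m \<ge> a \<longrightarrow> a = m"
  proof (rule predicate_Zorn)
    show "partial_order_on A (relation_of (\<ge>) A)"
      by (rule partial_order_on_relation_ofI) auto
    fix C assume "C \<in> Chains (relation_of (\<ge>) A)"
    then have CA: "C \<subseteq> A" and ch: "\<And>a b. a \<in> C \<Longrightarrow> b \<in> C \<Longrightarrow> a \<le> b \<or> b \<le> a"
      unfolding Chains_def relation_of_def by blast+
    show "\<exists>u\<in>A. \<forall>a\<in>C. u \<le> a"
    proof (cases "C = {}")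
      case True
      then show ?thesis using p by (auto simp: A_def)
    next
      case False
      define u where "u x = (INF a\<in>C. a x)" for x
      have sub: "sublinear a" and ap: "a x \<le> p x" if "a \<in> C" for a x
        using that CA by (auto simp: A_def le_fun_def)
      have bdd: "bdd_below ((\<lambda>a. a x) ` C)" for x
      proof (rule bdd_belowI2[of _ "- p (- x)"])
        fix a assume "a \<in> C"
        then show "- p (- x) \<le> a x"
          using sublinear_lower_bound(1)[OF sub, of a x] ap[of a "- x"] by linarith
      qed
      have le: "u x \<le> a x" if "a \<in> C" for a x
        unfolding u_def by (rule cINF_lower[OF bdd that])
      have ge: "c \<le> u x" if "\<And>a. a \<in> C \<Longrightarrow> c \<le> a x" for c x
        unfolding u_def by (rule cINF_greatest[OF False]) (use that in auto)
      have "sublinear u"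
      proof (rule sublinearI)
        fix x y
        have *: "u (x + y) \<le> a x + b y" if "a \<in> C" "b \<in> C" for a b
        proof -
          have "\<exists>c\<in>C. c \<le> a \<and> c \<le> b" using ch[OF that] that by auto
          then obtain c where c: "c \<in> C" "c \<le> a" "c \<le> b" by blast
          have "u (x + y) \<le> c (x + y)" by (rule le[OF c(1)])
          also have "\<dots> \<le> c x + c y" using sub[OF c(1)] by (simp add: sublinear_def)
          also have "\<dots> \<le> a x + b y" using c by (intro add_mono) (auto simp: le_fun_def)
          finally show ?thesis .
        qed
        have "u (x + y) - b y \<le> u x" if "b \<in> C" for b
          by (rule ge) (use *[OF _ that] in \<open>simp add: algebra_simps\<close>)
        then have "u (x + y) - u x \<le> u y"
          by (intro ge) (simp add: algebra_simps)
        then show "u (x + y) \<le> u x + u y" by simp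
      next
        show "u 0 = 0"
          using False by (simp add: u_def sublinear_lower_bound(2)[OF sub] cong: image_cong)
      next
        fix t :: real and x assume t: "t > 0"
        have "u (t *\<^sub>R x) / t \<le> u x"
        proof (rule ge)
          fix a assume a: "a \<in> C"
          have "u (t *\<^sub>R x) \<le> a (t *\<^sub>R x)" by (rule le[OF a])
          also have "\<dots> = t * a x" using sub[OF a] t by (simp add: sublinear_def)
          finally show "u (t *\<^sub>R x) / t \<le> a x" using t by (simp add: field_simps)
        qed
        then show "u (t *\<^sub>R x) \<le> t * u x" using t by (simp add: field_simps)
      qed
      moreover obtain a where "a \<in> C" using False by blast
      ultimately have "u \<in> A"
        using le[of a] ap[of a] by (auto simp: A_def le_fun_def intro: order_trans)
      then show ?thesis using le by (auto simp: le_fun_def)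
    qed
  qed
  then obtain m where m: "m \<in> A" "\<And>a. a \<in> A \<Longrightarrow> a \<le> m \<Longrightarrow> a = m" by blast
  show ?thesis
  proof (rule that)
    show "sublinear m" "m x \<le> p x" for x using m(1) by (auto simp: A_def le_fun_def)
    fix q assume "sublinear q" "\<And>x. q x \<le> m x"
    then show "q = m" using m by (intro m(2)) (auto simp: A_def le_fun_def intro: order_trans)
  qed
qed

theorem Hahn_Banach_sublinear:
  assumes p: "sublinear (p :: 'a::real_vector \<Rightarrow> real)"
  obtains g where "linear g" "\<And>x. g x \<le> p x" "g x0 = p x0"
proof -
  obtain q where q: "sublinear q" "\<And>x. q x \<le> p x" "q (- x0) \<le> - p x0"
    using sublinear_lower_along[OF p, of x0] by blast
  obtain m where m: "sublinear m" "\<And>x. m x \<le> q x"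
    and min: "\<And>r. sublinear r \<Longrightarrow> (\<And>x. r x \<le> m x) \<Longrightarrow> r = m"
    by (rule sublinear_minimal_below[OF q(1)]) blast
  have neg: "m (- x) = - m x" for x
  proof -
    obtain r where r: "sublinear r" "\<And>y. r y \<le> m y" "r (- x) \<le> - m x"
      using sublinear_lower_along[OF m(1), of x] by blast
    from min[OF r(1,2)] r(3) have "m (- x) \<le> - m x" by simp
    with sublinear_lower_bound(1)[OF m(1), of x] show ?thesis by simp
  qed
  have le: "m (x + y) \<le> m x + m y" for x y using m(1) by (simp add: sublinear_def)
  have add: "m (x + y) = m x + m y" for x y
    using le[of x y] le[of "- x" "- y"] neg[of "x + y"] neg[of x] neg[of y] by simp
  have pos: "m (t *\<^sub>R x) = t * m x" if "t \<ge> 0" for t x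
    using m(1) that by (simp add: sublinear_def)
  have "m (t *\<^sub>R x) = t * m x" for t x
    using pos[of t x] pos[of "- t" x] neg[of "t *\<^sub>R x"] by (cases "t \<ge> 0") auto
  then have "linear m" by (intro linearI) (use add in auto)
  moreover have "m x \<le> p x" for x using m(2)[of x] q(2)[of x] by simp
  moreover have "m x0 = p x0" using neg[of x0] m(2)[of "- x0"] q(3) m(2)[of x0] q(2)[of x0] by simp
  ultimately show ?thesis by (rule that)
qed

lemma csubspace_scaleR: "csubspace V \<Longrightarrow> x \<in> V \<Longrightarrow> r *\<^sub>R x \<in> V"
  using complex_vector.subspace_scale[of V x "complex_of_real r"] by (simp add: scaleC_of_real)

lemma csubspace_imp_subspace: "csubspace V \<Longrightarrow> subspace V"
  by (simp add: subspace_def complex_vector.subspace_0 complex_vector.subspace_add csubspace_scaleR)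

lemma sublinear_infdist:
  assumes V: "subspace (V :: 'a::real_normed_vector set)"
  shows "sublinear (\<lambda>x. infdist x V)"
proof (rule sublinearI)
  have ne: "V \<noteq> {}" and z: "0 \<in> V" using subspace_0[OF V] by auto
  have ap: "\<exists>v\<in>V. dist x v < e" if "infdist x V < e" for x e
    using that ne cInf_lessD[of "dist x ` V" e] by (auto simp: infdist_notempty)
  fix x y :: 'a
  show "infdist (x + y) V \<le> infdist x V + infdist y V"
  proof (rule field_le_epsilon)
    fix e :: real assume "e > 0"
    obtain v where v: "v \<in> V" "dist x v < infdist x V + e/2" using ap[of x "infdist x V + e/2"] \<open>e > 0\<close> by auto
    obtain w where w: "w \<in> V" "dist y w < infdist y V + e/2" using ap[of y "infdist y V + e/2"] \<open>e > 0\<close> by auto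
    have "infdist (x + y) V \<le> dist (x + y) (v + w)" by (rule infdist_le) (use v w V in \<open>simp add: subspace_add\<close>)
    also have "\<dots> \<le> dist x v + dist y w" by (rule dist_triangle_add)
    finally show "infdist (x + y) V \<le> infdist x V + infdist y V + e" using v w by simp
  qed
  show "infdist 0 V = 0" using z by simp
  fix t :: real assume t: "t > 0"
  show "infdist (t *\<^sub>R x) V \<le> t * infdist x V"
  proof (rule field_le_epsilon)
    fix e :: real assume "e > 0"
    obtain v where v: "v \<in> V" "dist x v < infdist x V + e/t" using ap[of x "infdist x V + e/t"] \<open>e > 0\<close> t by auto
    have "infdist (t *\<^sub>R x) V \<le> dist (t *\<^sub>R x) (t *\<^sub>R v)" by (rule infdist_le) (use v V in \<open>simp add: subspace_scale\<close>)
    also have "\<dots> = t * dist x v" using t by (simp add: dist_norm flip: scaleR_diff_right)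
    also have "\<dots> \<le> t * (infdist x V + e/t)" using v t by (intro mult_left_mono) auto
    also have "\<dots> = t * infdist x V + e" using t by (simp add: distrib_left)
    finally show "infdist (t *\<^sub>R x) V \<le> t * infdist x V + e" .
  qed
qed

definition bounded_cfunctional :: "('a::complex_normed_vector \<Rightarrow> complex) \<Rightarrow> bool" where
  "bounded_cfunctional \<phi> \<longleftrightarrow> bounded_linear \<phi> \<and> (\<forall>c x. \<phi> (c *\<^sub>C x) = c * \<phi> x)"

lemma bounded_cfunctionalD:
  assumes "bounded_cfunctional \<phi>"
  shows "bounded_linear \<phi>" "\<phi> (c *\<^sub>C x) = c * \<phi> x"
  using assms by (auto simp: bounded_cfunctional_def)

text \<open>
  The distance to \<open>V\<close> is a seminorm that vanishes exactly on \<open>V\<close>. A real functional \<open>g\<close> that it dominates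
  and with which it agrees at \<open>b\<close> is the real part of the complex functional
  \<open>g x - \<i> g (\<i> x)\<close>, which is then normalised at \<open>b\<close>.
\<close>
lemma complex_functional_separating:
  fixes V :: "'a::complex_normed_vector set"
  assumes V: "csubspace V" "closed V" and b: "b \<notin> V"
  obtains \<phi> where "bounded_cfunctional \<phi>" "\<forall>v\<in>V. \<phi> v = 0" "\<phi> b = 1"
proof -
  have ne: "V \<noteq> {}" and z: "0 \<in> V" using complex_vector.subspace_0[OF V(1)] by auto
  obtain g where g: "linear g" "\<And>x. g x \<le> infdist x V" "g b = infdist b V"
    using Hahn_Banach_sublinear[OF sublinear_infdist[OF csubspace_imp_subspace[OF V(1)]]] by blast
  have gb: "g b > 0" using infdist_pos_not_in_closed[OF V(2) ne b] g(3) by simp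
  interpret g: linear g by (rule g(1))
  have gV: "g v = 0" if "v \<in> V" for v
    using g(2)[of v] g(2)[of "- v"] g.neg[of v] that complex_vector.subspace_neg[OF V(1) that] by simp
  have gn: "\<bar>g x\<bar> \<le> norm x" for x
    using g(2)[of x] g(2)[of "- x"] g.neg[of x] infdist_le[OF z, of x] infdist_le[OF z, of "- x"] by simp
  define \<psi> where "\<psi> x = Complex (g x) (- g (\<i> *\<^sub>C x))" for x
  have cx: "c *\<^sub>C x = Re c *\<^sub>R x + Im c *\<^sub>R (\<i> *\<^sub>C x)" for c and x :: 'a
  proof -
    have "c = complex_of_real (Re c) + complex_of_real (Im c) * \<i>" by (simp add: complex_eq_iff)
    then have "c *\<^sub>C x = (complex_of_real (Re c) + complex_of_real (Im c) * \<i>) *\<^sub>C x" by (rule arg_cong)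
    then show ?thesis by (simp add: scaleC_add_left scaleC_of_real flip: scaleC_scaleC)
  qed
  have ii: "\<i> *\<^sub>C (c *\<^sub>C x) = (- Im c) *\<^sub>R x + Re c *\<^sub>R (\<i> *\<^sub>C x)" for c and x :: 'a
    using cx[of "\<i> * c" x] by (simp add: scaleC_scaleC)
  have add: "\<psi> (x + y) = \<psi> x + \<psi> y" for x y
    by (simp add: \<psi>_def complex_eq_iff g.add scaleC_add_right)
  have sc: "\<psi> (c *\<^sub>C x) = c * \<psi> x" for c x
  proof -
    have "g (c *\<^sub>C x) = Re c * g x + Im c * g (\<i> *\<^sub>C x)" by (subst cx) (simp add: g.add g.scale)
    moreover have "g (\<i> *\<^sub>C (c *\<^sub>C x)) = - Im c * g x + Re c * g (\<i> *\<^sub>C x)"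
      by (subst ii) (simp add: g.add g.scale g.diff g.neg)
    ultimately show ?thesis by (simp add: \<psi>_def complex_eq_iff)
  qed
  have n: "norm (\<psi> x) \<le> norm x * 2" for x
    using cmod_le[of "\<psi> x"] gn[of x] gn[of "\<i> *\<^sub>C x"] by (simp add: \<psi>_def norm_scaleC)
  have "bounded_linear \<psi>"
    by (rule bounded_linear_intro[of _ 2])
       (use add n sc[of "complex_of_real _"] in \<open>auto simp: scaleC_of_real scaleR_conv_of_real\<close>)
  have "Re (\<psi> b) > 0" using gb by (simp add: \<psi>_def)
  then have nz: "\<psi> b \<noteq> 0" by auto
  have \<psi>V: "\<psi> v = 0" if "v \<in> V" for v
    using gV[OF that] gV[OF complex_vector.subspace_scale[OF V(1) that, of "\<i>"]] by (simp add: \<psi>_def complex_eq_iff)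
  show ?thesis
  proof (rule that[of "\<lambda>x. \<psi> x / \<psi> b"])
    have "bounded_linear (\<lambda>x. \<psi> x / \<psi> b)"
      using bounded_linear_divide \<open>bounded_linear \<psi>\<close> bounded_linear_compose by blast
    then show "bounded_cfunctional (\<lambda>x. \<psi> x / \<psi> b)"
      by (simp add: bounded_cfunctional_def sc)
  qed (use \<psi>V nz in auto)
qed

lemma complex_functional_nonzero:
  fixes b :: "'a::complex_normed_vector"
  assumes "b \<noteq> 0"
  obtains \<phi> where "bounded_cfunctional \<phi>" "\<phi> b = 1"
  using complex_functional_separating[of "{0}" b] assms complex_vector.subspace_single_0 by (metis closed_singleton singletonD)

section \<open>The open mapping theorem for closed images\<close>

lemma complete_top_of_closed:
  fixes W :: "'a::complete_space set" assumes "closed W"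
  shows "completely_metrizable_space (top_of_set W)"
  using assms completely_metrizable_space_closedin completely_metrizable_space_euclidean
  by (metis closed_closedin)

text \<open>
  By Baire's theorem in the complete space \<open>f ` V\<close>, the closure of the image of some ball of \<open>V\<close>
  contains a relative ball around some point \<open>y\<close>. Differences of approximate preimages of \<open>y + w\<close>
  and of \<open>y\<close> then give approximate preimages of every small \<open>w\<close>, and scaling reaches all \<open>w\<close>.
\<close>
lemma image_closed_nearly_open:
  fixes f :: "'b::banach \<Rightarrow> 'a::banach"
  assumes f: "bounded_linear f" and V: "subspace V" and W: "closed (f ` V)"
  obtains C where "C \<ge> 0" 
    "\<And>w \<delta>. w \<in> f ` V \<Longrightarrow> \<delta> > 0 \<Longrightarrow> \<exists>v\<in>V. norm v \<le> C * norm w \<and> norm (w - f v) < \<delta>"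
proof -
  interpret f: bounded_linear f by (rule f)
  define W where "W = f ` V"
  have sW: "subspace W" unfolding W_def by (rule linear_subspace_image[OF f.linear_axioms V])
  define A where "A n = closure (f ` (V \<inter> cball 0 (real n)))" for n
  have AW: "A n \<subseteq> W" for n
    unfolding A_def W_def by (rule closure_minimal[OF _ W]) auto
  have un: "\<Union> (range A) = W"
  proof (intro equalityI subsetI)
    fix w assume "w \<in> W"
    then obtain v where v: "v \<in> V" "w = f v" by (auto simp: W_def)
    obtain n where "norm v \<le> real n" using real_arch_simple by blast
    with v have "w \<in> f ` (V \<inter> cball 0 (real n))" by auto
    then have "w \<in> A n" unfolding A_def by (rule closure_subset[THEN subsetD])
    then show "w \<in> \<Union> (range A)" by blast
  qed (use AW in auto)
  have "\<exists>n. top_of_set W interior_of A n \<noteq> {}"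
  proof (rule ccontr)
    assume "\<nexists>n. top_of_set W interior_of A n \<noteq> {}"
    then have "top_of_set W interior_of \<Union> (range A) = {}"
      using complete_top_of_closed[OF W] AW
      by (intro Baire_category_alt) (auto simp: W_def A_def intro!: closed_subset dest!: subsetD[OF AW[unfolded A_def W_def]])
    moreover have "top_of_set W interior_of W = W"
      by (metis interior_of_topspace topspace_euclidean_subtopology)
    moreover have "0 \<in> W" by (rule subspace_0[OF sW])
    ultimately show False using un by auto
  qed
  then obtain n y where "y \<in> top_of_set W interior_of A n" by blast
  then obtain U where U: "openin (top_of_set W) U" "y \<in> U" "U \<subseteq> A n"
    by (auto simp: interior_of_def)
  then obtain e where e: "e > 0" "ball y e \<inter> W \<subseteq> A n" and yW: "y \<in> W"
    by (metis openin_contains_ball openin_imp_subset subset_iff subset_trans)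
  have yA: "y \<in> A n" using U by blast
  have key: "\<exists>v\<in>V. norm v \<le> 2 * real n \<and> norm (w - f v) < \<delta>" if w: "w \<in> W" "norm w < e" and d: "\<delta> > 0" for w \<delta>
  proof -
    have "y + w \<in> A n" using e w yW sW by (auto simp: dist_norm subspace_add)
    then obtain a where a: "a \<in> V" "norm a \<le> real n" "dist (f a) (y + w) < \<delta>/2"
      using d unfolding A_def closure_approachable by (force dest: spec[of _ "\<delta>/2"])
    from yA obtain b where b: "b \<in> V" "norm b \<le> real n" "dist (f b) y < \<delta>/2"
      using d unfolding A_def closure_approachable by (force dest: spec[of _ "\<delta>/2"])
    have "norm (w - f (a - b)) = norm ((f b - y) - (f a - (y + w)))" by (simp add: f.diff algebra_simps)
    also have "\<dots> \<le> norm (f b - y) + norm (f a - (y + w))" by (rule norm_triangle_ineq4)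
    also have "\<dots> < \<delta>" using a b by (simp add: dist_norm)
    finally have "norm (w - f (a - b)) < \<delta>" .
    moreover have "norm (a - b) \<le> 2 * real n" using norm_triangle_ineq4[of a b] a b by linarith
    ultimately show ?thesis using subspace_diff[OF V a(1) b(1)] by blast
  qed
  \<comment> \<open>A vector of norm at most \<open>e / 2\<close> has approximate preimages of norm at most \<open>2 n\<close>.\<close>
  define C where "C = 4 * real n / e"
  show ?thesis
  proof (rule that[of C])
    show "C \<ge> 0" using e by (simp add: C_def)
    fix w and \<delta> :: real assume w: "w \<in> f ` V" and d: "\<delta> > 0"
    show "\<exists>v\<in>V. norm v \<le> C * norm w \<and> norm (w - f v) < \<delta>"
    proof (cases "w = 0")
      case True
      then show ?thesis using d subspace_0[OF V] by (intro bexI[of _ 0]) auto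
    next
      case False
      define t where "t = e / (2 * norm w)"
      have t: "t > 0" using False e by (simp add: t_def)
      have "norm (t *\<^sub>R w) < e" using False e by (simp add: t_def)
      moreover have "t *\<^sub>R w \<in> W" using w sW by (simp add: W_def subspace_scale)
      ultimately obtain v where v: "v \<in> V" "norm v \<le> 2 * real n" "norm (t *\<^sub>R w - f v) < t * \<delta>"
        using key[of "t *\<^sub>R w" "t * \<delta>"] t d by auto
      have "norm (w - f ((1/t) *\<^sub>R v)) = norm ((1/t) *\<^sub>R (t *\<^sub>R w - f v))"
        using t by (simp add: f.scaleR algebra_simps)
      also have "\<dots> = (1/t) * norm (t *\<^sub>R w - f v)" using t by simp
      also have "\<dots> < (1/t) * (t * \<delta>)" using t v(3) by (intro mult_strict_left_mono) auto
      finally have "norm (w - f ((1/t) *\<^sub>R v)) < \<delta>" using t by simp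
      moreover have "norm ((1/t) *\<^sub>R v) \<le> C * norm w"
      proof -
        have "norm ((1/t) *\<^sub>R v) = (1/t) * norm v" using t by simp
        also have "\<dots> \<le> (1/t) * (2 * real n)" using v(2) t by (intro mult_left_mono) auto
        also have "\<dots> = C * norm w" using False e by (simp add: t_def C_def field_simps)
        finally show ?thesis .
      qed
      ultimately show ?thesis using v(1) subspace_scale[OF V] by blast
    qed
  qed
qed

text \<open>
  The open mapping theorem, in the form of a norm bound for preimages. Correcting an approximate
  preimage repeatedly, with an error halved each time, sums to an exact preimage. The domain and the
  range are different types so that the theorem also applies to the addition map on a product, which
  gives the continuity of the projections of a direct sum.
\<close>
theorem closed_image_bounded_preimages:
  fixes f :: "'b::banach \<Rightarrow> 'a::banach"
  assumes f: "bounded_linear f" and V: "subspace V" "closed V" and W: "closed (f ` V)"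
  obtains C where "C > 0" "\<And>w. w \<in> f ` V \<Longrightarrow> \<exists>v\<in>V. f v = w \<and> norm v \<le> C * norm w"
proof -
  interpret f: bounded_linear f by (rule f)
  obtain C where C: "C \<ge> 0"
    "\<And>w \<delta>. w \<in> f ` V \<Longrightarrow> \<delta> > 0 \<Longrightarrow> \<exists>v\<in>V. norm v \<le> C * norm w \<and> norm (w - f v) < \<delta>"
    by (rule image_closed_nearly_open[OF f V(1) W]) blast
  have "\<exists>v\<in>V. f v = w \<and> norm v \<le> (2 * C + 1) * norm w" if w: "w \<in> f ` V" for w
  proof (cases "w = 0")
    case True
    then show ?thesis using subspace_0[OF V(1)] by (intro bexI[of _ 0]) auto
  next
    case False
    define g where "g u = (SOME v. v \<in> V \<and> norm v \<le> C * norm u \<and> norm (u - f v) \<le> norm u / 2)" for u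
    have g: "g u \<in> V \<and> norm (g u) \<le> C * norm u \<and> norm (u - f (g u)) \<le> norm u / 2" if u: "u \<in> f ` V" for u
    proof -
      have "\<exists>v. v \<in> V \<and> norm v \<le> C * norm u \<and> norm (u - f v) \<le> norm u / 2"
      proof (cases "u = 0")
        case True
        then show ?thesis using subspace_0[OF V(1)] by (intro exI[of _ 0]) auto
      next
        case False
        then show ?thesis using C(2)[OF u, of "norm u / 2"] by (auto intro: less_imp_le)
      qed
      then show ?thesis unfolding g_def by (rule someI_ex)
    qed
    define r where "r n = ((\<lambda>u. u - f (g u)) ^^ n) w" for n
    have r0: "r 0 = w" and rS: "r (Suc n) = r n - f (g (r n))" for n by (simp_all add: r_def)
    have rV: "r n \<in> f ` V" for n
    proof (induction n)
      case (Suc n)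
      show ?case unfolding rS using Suc g[OF Suc]
        by (intro subspace_diff linear_subspace_image[OF f.linear_axioms] V) auto
    qed (use w r0 in simp)
    have rn: "norm (r n) \<le> norm w * (1/2)^n" for n
    proof (induction n)
      case (Suc n)
      then show ?case using g[OF rV[of n]] by (simp add: rS)
    qed (simp add: r0)
    have gn: "norm (g (r n)) \<le> C * norm w * (1/2)^n" for n
      using g[OF rV[of n]] mult_left_mono[OF rn[of n] C(1)] by (simp add: mult.assoc)
    have geo: "(\<lambda>n. C * norm w * (1/2)^n) sums (C * norm w * 2)"
      using sums_mult[OF geometric_sums[of "1/2::real"], of "C * norm w"] by simp
    have sn: "summable (\<lambda>n. norm (g (r n)))"
      by (rule summable_comparison_test'[OF sums_summable[OF geo], of 0]) (use gn in simp)
    then have s: "summable (\<lambda>n. g (r n))" by (rule summable_norm_cancel)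
    define v where "v = (\<Sum>n. g (r n))"
    have lim: "(\<lambda>n. \<Sum>k<n. g (r k)) \<longlonglongrightarrow> v"
      using s unfolding v_def by (rule summable_LIMSEQ)
    have vV: "v \<in> V"
      by (rule closed_sequentially[OF V(2) _ lim]) (use g rV V(1) in \<open>auto intro: subspace_sum\<close>)
    have "norm v \<le> (\<Sum>n. norm (g (r n)))" unfolding v_def by (rule summable_norm[OF sn])
    also have "\<dots> \<le> C * norm w * 2"
      using suminf_le[OF gn sn sums_summable[OF geo]] sums_unique[OF geo] by simp
    also have "\<dots> \<le> (2 * C + 1) * norm w" by (simp add: algebra_simps)
    finally have nv: "norm v \<le> (2 * C + 1) * norm w" .
    have part: "f (\<Sum>k<n. g (r k)) = w - r n" for n
      by (induction n) (simp_all add: r0 rS f.zero f.add)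
    have "(\<lambda>n. norm w * (1/2)^n) \<longlonglongrightarrow> 0"
      using tendsto_mult_right_zero[OF LIMSEQ_power_zero[of "1/2::real"]] by simp
    then have "r \<longlonglongrightarrow> 0" by (rule Lim_null_comparison[rotated]) (use rn in \<open>auto intro!: always_eventually\<close>)
    then have "(\<lambda>n. w - r n) \<longlonglongrightarrow> w - 0" by (intro tendsto_intros)
    moreover have "(\<lambda>n. w - r n) \<longlonglongrightarrow> f v" using f.tendsto[OF lim] by (simp add: part)
    ultimately have "f v = w" using LIMSEQ_unique by fastforce
    then show ?thesis using vV nv by blast
  qed
  then show ?thesis using C(1) by (intro that[of "2 * C + 1"]) auto
qed

section \<open>Bounded complex-linear operators\<close>

abbreviation subspace_sum :: "'a::plus set \<Rightarrow> 'a set \<Rightarrow> 'a set" where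
  "subspace_sum V W \<equiv> {x + y | x y. x \<in> V \<and> y \<in> W}"

abbreviation closed_csubspace :: "'a::complex_normed_vector set \<Rightarrow> bool" where
  "closed_csubspace M \<equiv> csubspace M \<and> closed M"

lemma bounded_clinear_imp_bounded_linear: "bounded_clinear S \<Longrightarrow> bounded_linear S"
  by (simp add: bounded_clinear_iff)

lemma bounded_clinear_scaleC: "bounded_clinear S \<Longrightarrow> S (c *\<^sub>C x) = c *\<^sub>C S x"
  by (simp add: bounded_clinear_iff)

lemma bounded_linear_scaleC: "bounded_linear (\<lambda>x::'a::complex_normed_vector. c *\<^sub>C x)"
proof (rule bounded_linear_intro[of _ "cmod c"])
  show "c *\<^sub>C r *\<^sub>R x = r *\<^sub>R c *\<^sub>C x" for r and x :: 'a
    by (simp add: scaleC_scaleC mult.commute flip: scaleC_of_real)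
qed (simp_all add: scaleC_add_right norm_scaleC)

lemma bounded_linear_scaleC_left: "bounded_linear (\<lambda>c. c *\<^sub>C (x::'a::complex_normed_vector))"
  by (rule bounded_linear_intro[of _ "norm x"])
     (simp_all add: scaleC_add_left norm_scaleC scaleR_conv_of_real scaleC_scaleC flip: scaleC_of_real)

lemma bounded_clinear_shift_op:
  assumes "bounded_clinear S" shows "bounded_clinear (shift_op S z)"
proof -
  have "bounded_linear (shift_op S z)"
    unfolding shift_op_def using assms
    by (intro bounded_linear_sub bounded_clinear_imp_bounded_linear bounded_linear_scaleC)
  moreover have "shift_op S z (c *\<^sub>C x) = c *\<^sub>C shift_op S z x" for c x
    using assms
    by (simp add: shift_op_def bounded_clinear_scaleC complex_vector.scale_right_diff_distrib scaleC_scaleC mult.commute)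
  ultimately show ?thesis by (simp add: bounded_clinear_iff)
qed

lemma shift_op_shift_op: "shift_op (shift_op S z) w = shift_op S (z + w)"
  by (simp add: shift_op_def scaleC_add_left fun_eq_iff algebra_simps)

lemma csubspace_image:
  assumes S: "bounded_clinear S" and V: "csubspace V"
  shows "csubspace (S ` V)"
proof -
  interpret S: bounded_linear S by (rule bounded_clinear_imp_bounded_linear[OF S])
  show ?thesis
  proof (rule complex_vector.subspaceI)
    show "0 \<in> S ` V" using S.zero complex_vector.subspace_0[OF V] by force
    show "x + y \<in> S ` V" if "x \<in> S ` V" "y \<in> S ` V" for x y
      using that by (auto simp flip: S.add intro!: imageI complex_vector.subspace_add[OF V])
    show "c *\<^sub>C x \<in> S ` V" if "x \<in> S ` V" for c x
      using that by (auto simp flip: bounded_clinear_scaleC[OF S] intro!: imageI complex_vector.subspace_scale[OF V])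
  qed
qed

lemma csubspace_kernel_on:
  assumes S: "bounded_clinear S" and V: "csubspace V"
  shows "csubspace (kernel_on V S)"
proof -
  interpret S: bounded_linear S by (rule bounded_clinear_imp_bounded_linear[OF S])
  show ?thesis
    by (rule complex_vector.subspaceI)
      (auto simp: kernel_on_def S.zero S.add bounded_clinear_scaleC[OF S] complex_vector.subspace_0[OF V]
        intro: complex_vector.subspace_add[OF V] complex_vector.subspace_scale[OF V])
qed

section \<open>Finite-dimensional subspaces of a normed space\<close>

lemma finite_cdim_subset: "finite_cdim W \<Longrightarrow> V \<subseteq> W \<Longrightarrow> finite_cdim V"
  unfolding finite_cdim_def by blast

lemma finite_cdim_obtain_span:
  assumes "finite_cdim V" "csubspace V"
  obtains B where "finite B" "V = cspan B"
proof -
  obtain B0 where B0: "finite B0" "V \<subseteq> cspan B0" using assms(1) by (auto simp: finite_cdim_def)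
  obtain B where B: "B \<subseteq> V" "\<not> complex_vector.dependent B" "V \<subseteq> cspan B"
    by (rule complex_vector.basis_exists)
  have "finite B" using complex_vector.independent_span_bound[OF B0(1) B(2)] B(1) B0(2) by blast
  moreover have "V = cspan B"
    using B complex_vector.span_minimal[OF B(1) assms(2)] by blast
  ultimately show ?thesis by (rule that)
qed

lemma dim_strict_mono_finite_cdim:
  assumes W: "finite_cdim W" and V: "csubspace V" "V \<subset> W"
  shows "complex_vector.dim V < complex_vector.dim W"
proof -
  obtain B0 where B0: "finite B0" "W \<subseteq> cspan B0" using W by (auto simp: finite_cdim_def)
  obtain B where B: "B \<subseteq> V" "\<not> complex_vector.dependent B" "V \<subseteq> cspan B" "card B = complex_vector.dim V"
    by (rule complex_vector.basis_exists)
  obtain C where C: "C \<subseteq> W" "\<not> complex_vector.dependent C" "W \<subseteq> cspan C" "card C = complex_vector.dim W"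
    by (rule complex_vector.basis_exists)
  have fC: "finite C" using complex_vector.independent_span_bound[OF B0(1) C(2)] C(1) B0(2) by blast
  obtain w where w: "w \<in> W" "w \<notin> V" using V by blast
  have "w \<notin> cspan B" using w complex_vector.span_minimal[OF B(1) V(1)] by blast
  then have i: "\<not> complex_vector.dependent (insert w B)" and "w \<notin> B"
    using complex_vector.independent_insertI[OF _ B(2)] complex_vector.span_base by auto
  have "insert w B \<subseteq> cspan C" using w B(1) V(2) C(3) by blast
  from complex_vector.independent_span_bound[OF fC i this]
  have "finite (insert w B)" "card (insert w B) \<le> card C" by auto
  then show ?thesis using \<open>w \<notin> B\<close> B(4) C(4) by simp
qed

text \<open>
  The dimensions attain a least value, and a later proper inclusion would lower it further.
\<close>
lemma decreasing_csubspaces_stabilize: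
  assumes V: "\<And>n. csubspace (V n)" and dec: "\<And>m n. m \<le> n \<Longrightarrow> V n \<subseteq> V m" and fd: "finite_cdim (V (0::nat))"
  obtains n where "\<And>m. m \<ge> n \<Longrightarrow> V m = V n"
proof -
  obtain n where n: "\<And>m. complex_vector.dim (V n) \<le> complex_vector.dim (V m)"
    using exists_least_iff[of "\<lambda>k. \<exists>n. complex_vector.dim (V n) = k"] by (metis le_less_linear)
  have "V m = V n" if "m \<ge> n" for m
  proof (rule ccontr)
    assume "V m \<noteq> V n"
    then have "V m \<subset> V n" using dec[OF that] by blast
    then have "complex_vector.dim (V m) < complex_vector.dim (V n)"
      using dim_strict_mono_finite_cdim[OF finite_cdim_subset[OF fd dec] V] by simp
    then show False using n[of m] by simp
  qed
  then show ?thesis by (rule that)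
qed

text \<open>
  Modulo \<open>K\<close> the subspace \<open>V\<close> embeds into \<open>cspan B\<close>. The induction peels off one spanning vector
  \<open>b\<close>: the elements of \<open>V\<close> with no \<open>b\<close>-coordinate are covered by the induction hypothesis, and a
  single further element \<open>v0\<close> of \<open>V\<close> accounts for that coordinate.
\<close>
lemma finite_cdim_of_disjoint:
  assumes "finite B" "csubspace K" "csubspace V" "V \<inter> K = {0}" "V \<subseteq> subspace_sum K (cspan B)"
  shows "finite_cdim V"
  using assms(1,3,4,5)
proof (induction B arbitrary: V rule: finite_induct)
  case empty
  then have "V \<subseteq> cspan {}" by auto
  then show ?case unfolding finite_cdim_def by blast
next
  case (insert b B)
  define W where "W = subspace_sum K (cspan B)"
  have sW: "csubspace W" unfolding W_def
    using assms(2) complex_vector.subspace_span by (rule complex_vector.subspace_sums)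
  have "finite_cdim (V \<inter> W)"
  proof (rule insert.IH)
    show "csubspace (V \<inter> W)" using insert.prems(1) sW by (rule complex_vector.subspace_inter)
    then show "V \<inter> W \<inter> K = {0}" using insert.prems(2) complex_vector.subspace_0 by blast
  qed (auto simp: W_def)
  then obtain B' where B': "finite B'" "V \<inter> W \<subseteq> cspan B'" by (auto simp: finite_cdim_def)
  have coord: "\<exists>c. v - c *\<^sub>C b \<in> W" if v: "v \<in> V" for v
  proof -
    obtain k s where ks: "v = k + s" "k \<in> K" "s \<in> cspan (insert b B)" using subsetD[OF insert.prems(3) v] by blast
    then obtain c where "s - c *\<^sub>C b \<in> cspan B" by (auto simp: complex_vector.span_insert)
    then show ?thesis using ks unfolding W_def
      by (intro exI[of _ c] CollectI exI[of _ k] exI[of _ "s - c *\<^sub>C b"]) (auto simp: algebra_simps)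
  qed
  show ?case
  proof (cases "V \<subseteq> W")
    case True
    then show ?thesis using B' unfolding finite_cdim_def by blast
  next
    case False
    then obtain v0 where v0: "v0 \<in> V" "v0 \<notin> W" by blast
    obtain c0 where c0: "v0 - c0 *\<^sub>C b \<in> W" using coord[OF v0(1)] by blast
    have "c0 \<noteq> 0" using c0 v0 by auto
    have "v \<in> cspan (insert v0 B')" if v: "v \<in> V" for v
    proof -
      obtain c where c: "v - c *\<^sub>C b \<in> W" using coord[OF v] by blast
      have "(v - c *\<^sub>C b) - (c/c0) *\<^sub>C (v0 - c0 *\<^sub>C b) \<in> W"
        by (intro complex_vector.subspace_diff[OF sW] complex_vector.subspace_scale[OF sW] c c0)
      then have "v - (c/c0) *\<^sub>C v0 \<in> W"
        using \<open>c0 \<noteq> 0\<close> by (simp add: complex_vector.scale_right_diff_distrib scaleC_scaleC)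
      moreover have "v - (c/c0) *\<^sub>C v0 \<in> V"
        using insert.prems(1) v v0 by (intro complex_vector.subspace_diff complex_vector.subspace_scale)
      ultimately have "v - (c/c0) *\<^sub>C v0 \<in> cspan B'" using B' by blast
      then show ?thesis by (auto simp: complex_vector.span_insert)
    qed
    then show ?thesis using B'(1) unfolding finite_cdim_def by (metis finite_insert subsetI)
  qed
qed

text \<open>
  If \<open>b\<close> lies outside \<open>V\<close>, a bounded functional that vanishes on \<open>V\<close> with value 1 at \<open>b\<close> reads off the
  coefficient of \<open>b\<close>, so that the sum is the preimage of \<open>V\<close> under a continuous map.
\<close>
lemma closed_csubspace_add_line:
  fixes V :: "'a::complex_normed_vector set"
  assumes V: "closed_csubspace V"
  shows "closed {x. \<exists>k. x - k *\<^sub>C b \<in> V}"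
proof (cases "b \<in> V")
  case True
  have "{x. \<exists>k. x - k *\<^sub>C b \<in> V} = V"
  proof (intro equalityI subsetI)
    fix x assume "x \<in> {x. \<exists>k. x - k *\<^sub>C b \<in> V}"
    then obtain k where k: "x - k *\<^sub>C b \<in> V" by blast
    have "k *\<^sub>C b \<in> V" using V True by (intro complex_vector.subspace_scale) auto
    from complex_vector.subspace_add[OF conjunct1[OF V] k this] show "x \<in> V" by simp
  qed (auto intro!: exI[of _ 0])
  then show ?thesis using V by simp
next
  case False
  obtain \<phi> where \<phi>: "bounded_cfunctional \<phi>" "\<forall>v\<in>V. \<phi> v = 0" "\<phi> b = 1"
    using V False by (metis complex_functional_separating)
  note \<phi>_bl = bounded_cfunctionalD(1)[OF \<phi>(1)] and \<phi>_sc = bounded_cfunctionalD(2)[OF \<phi>(1)]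
  interpret \<phi>: bounded_linear \<phi> by (rule \<phi>_bl)
  have "{x. \<exists>k. x - k *\<^sub>C b \<in> V} = (\<lambda>x. x - \<phi> x *\<^sub>C b) -` V"
  proof (intro equalityI subsetI)
    fix x assume "x \<in> {x. \<exists>k. x - k *\<^sub>C b \<in> V}"
    then obtain k where k: "x - k *\<^sub>C b \<in> V" by blast
    have "\<phi> x = k" using \<phi>(2) k by (force simp: \<phi>.diff \<phi>_sc \<phi>(3))
    with k show "x \<in> (\<lambda>x. x - \<phi> x *\<^sub>C b) -` V" by simp
  qed auto
  moreover have "bounded_linear (\<lambda>x. x - \<phi> x *\<^sub>C b)"
    by (intro bounded_linear_sub bounded_linear_ident bounded_linear_compose[OF bounded_linear_scaleC_left \<phi>_bl])
  ultimately show ?thesis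
    using V by (metis closed_vimage linear_continuous_on continuous_on_eq_continuous_at open_UNIV)
qed

lemma closed_subspace_sum_cspan:
  assumes "finite B" and V: "closed_csubspace V"
  shows "closed (subspace_sum V (cspan B))"
  using assms(1)
proof (induction B rule: finite_induct)
  case empty
  then show ?case using V by simp
next
  case (insert b B)
  define W where "W = subspace_sum V (cspan B)"
  have "csubspace W" unfolding W_def
    using V complex_vector.subspace_span by (intro complex_vector.subspace_sums) auto
  then have "closed {x. \<exists>k. x - k *\<^sub>C b \<in> W}"
    using insert.IH by (intro closed_csubspace_add_line) (simp add: W_def)
  also have "{x. \<exists>k. x - k *\<^sub>C b \<in> W} = subspace_sum V (cspan (insert b B))"
  proof (intro equalityI subsetI)
    fix x assume "x \<in> {x. \<exists>k. x - k *\<^sub>C b \<in> W}"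
    then obtain k v s where "x - k *\<^sub>C b = v + s" "v \<in> V" "s \<in> cspan B" by (auto simp: W_def)
    then have "x = v + (s + k *\<^sub>C b)" "s + k *\<^sub>C b \<in> cspan (insert b B)"
      by (auto simp: complex_vector.span_insert algebra_simps intro!: exI[of _ k])
    then show "x \<in> subspace_sum V (cspan (insert b B))" using \<open>v \<in> V\<close> by blast
  next
    fix x assume "x \<in> subspace_sum V (cspan (insert b B))"
    then obtain v s k where "x = v + s" "v \<in> V" "s - k *\<^sub>C b \<in> cspan B"
      by (auto simp: complex_vector.span_insert)
    then have "x - k *\<^sub>C b = v + (s - k *\<^sub>C b)" by simp
    with \<open>v \<in> V\<close> \<open>s - k *\<^sub>C b \<in> cspan B\<close> show "x \<in> {x. \<exists>k. x - k *\<^sub>C b \<in> W}" unfolding W_def by blast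
  qed
  finally show ?case .
qed

lemma closed_subspace_sum_finite_cdim:
  assumes "finite_cdim F" "csubspace F" "closed_csubspace V"
  shows "closed (subspace_sum V F)"
proof -
  obtain B where "finite B" "F = cspan B" by (rule finite_cdim_obtain_span[OF assms(1,2)])
  then show ?thesis using closed_subspace_sum_cspan[OF _ assms(3)] by blast
qed

lemma closed_finite_cdim:
  fixes F :: "'a::complex_normed_vector set"
  assumes "finite_cdim F" "csubspace F"
  shows "closed F"
proof -
  have "subspace_sum {0} F = F" by auto
  then show ?thesis
    using closed_subspace_sum_finite_cdim[OF assms, of "{0}"] complex_vector.subspace_single_0 by auto
qed

text \<open>
  A new spanning vector \<open>b\<close> outside the span so far costs one bounded functional: the old complement is
  intersected with the kernel of a functional that vanishes on the old span and equals 1 at \<open>b\<close>.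
\<close>
lemma finite_dim_closed_complement:
  assumes "finite B"
  shows "\<exists>K :: 'a::complex_normed_vector set. closed_csubspace K \<and> K \<inter> cspan B = {0} \<and> (\<forall>x. \<exists>k\<in>K. x - k \<in> cspan B)"
  using assms
proof (induction B rule: finite_induct)
  case empty
  then show ?case
    by (intro exI[of _ UNIV]) (auto simp: complex_vector.subspace_UNIV)
next
  case (insert b B)
  then obtain K :: "'a set" where K: "closed_csubspace K" "K \<inter> cspan B = {0}" "\<And>x. \<exists>k\<in>K. x - k \<in> cspan B" by blast
  show ?case
  proof (cases "b \<in> cspan B")
    case True
    then show ?thesis using K by (metis complex_vector.span_redundant)
  next
    case False
    have "closed (cspan B)"
      using insert.hyps(1) complex_vector.subspace_span complex_vector.span_base
      by (intro closed_finite_cdim) (auto simp: finite_cdim_def)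
    then obtain \<phi> where \<phi>: "bounded_cfunctional \<phi>" "\<forall>v\<in>cspan B. \<phi> v = 0" "\<phi> b = 1"
      using False by (metis complex_functional_separating complex_vector.subspace_span)
    note \<phi>_bl = bounded_cfunctionalD(1)[OF \<phi>(1)] and \<phi>_sc = bounded_cfunctionalD(2)[OF \<phi>(1)]
    interpret \<phi>: bounded_linear \<phi> by (rule \<phi>_bl)
    define K' where "K' = K \<inter> \<phi> -` {0}"
    have "closed (\<phi> -` {0})"
      by (intro closed_vimage closed_singleton linear_continuous_on \<phi>_bl)
    then have "closed K'" using K(1) by (auto simp: K'_def)
    moreover have "csubspace K'"
      using K(1) by (intro complex_vector.subspaceI)
        (auto simp: K'_def \<phi>.zero \<phi>.add \<phi>_sc complex_vector.subspace_0 complex_vector.subspace_add complex_vector.subspace_scale)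
    moreover have "K' \<inter> cspan (insert b B) = {0}"
    proof (intro equalityI subsetI)
      fix x assume x: "x \<in> K' \<inter> cspan (insert b B)"
      then obtain k where k: "x - k *\<^sub>C b \<in> cspan B" by (auto simp: complex_vector.span_insert)
      have "k = 0" using bspec[OF \<phi>(2) k] x by (simp add: \<phi>.diff \<phi>_sc \<phi>(3) K'_def)
      then show "x \<in> {0}" using k x K(2) by (auto simp: K'_def)
    qed (use \<open>csubspace K'\<close> in \<open>auto simp: complex_vector.subspace_0 complex_vector.span_zero\<close>)
    moreover have "\<exists>k\<in>K'. x - k \<in> cspan (insert b B)" for x
    proof -
      obtain k where k: "k \<in> K" "x - k \<in> cspan B" using K(3) by blast
      obtain kb where kb: "kb \<in> K" "b - kb \<in> cspan B" using K(3) by blast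
      have p: "\<phi> kb = 1" using bspec[OF \<phi>(2) kb(2)] by (simp add: \<phi>.diff \<phi>(3))
      define k' where "k' = k - \<phi> k *\<^sub>C kb"
      have "k' \<in> K'"
        using K(1) k kb p by (auto simp: k'_def K'_def \<phi>.diff \<phi>_sc intro!: complex_vector.subspace_diff complex_vector.subspace_scale)
      moreover have "x - k' - \<phi> k *\<^sub>C b \<in> cspan B"
      proof -
        have "(x - k) - \<phi> k *\<^sub>C (b - kb) \<in> cspan B"
          by (intro complex_vector.span_diff complex_vector.span_scale k kb)
        then show ?thesis by (simp add: k'_def complex_vector.scale_right_diff_distrib algebra_simps)
      qed
      ultimately show ?thesis by (auto simp: complex_vector.span_insert)
    qed
    ultimately show ?thesis by blast
  qed
qed

section \<open>Upper semi-Fredholm operators on closed invariant subspaces\<close>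

lemma bounded_below_closed_image:
  fixes S :: "'a::complex_banach \<Rightarrow> 'a"
  assumes S: "bounded_clinear S" and K: "closed_csubspace K" and b: "bounded_below_on K S"
  shows "closed (S ` K)"
proof -
  obtain c where c: "c > 0" "\<And>x. x \<in> K \<Longrightarrow> c * norm x \<le> norm (S x)" using b by (auto simp: bounded_below_on_def)
  have "complete (S ` K)"
    using K c by (intro complete_isometric_image[of c])
      (auto simp: csubspace_imp_subspace bounded_clinear_imp_bounded_linear[OF S] complete_eq_closed)
  then show ?thesis by (rule complete_imp_closed)
qed

lemma injective_closed_range_bounded_below:
  fixes S :: "'a::complex_banach \<Rightarrow> 'a"
  assumes S: "bounded_clinear S" and K: "closed_csubspace K"
    and cl: "closed (S ` K)" and inj: "kernel_on K S \<subseteq> {0}"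
  shows "bounded_below_on K S"
proof -
  interpret S: bounded_linear S by (rule bounded_clinear_imp_bounded_linear[OF S])
  obtain C where C: "C > 0" "\<And>w. w \<in> S ` K \<Longrightarrow> \<exists>v\<in>K. S v = w \<and> norm v \<le> C * norm w"
    using closed_image_bounded_preimages[OF S.bounded_linear csubspace_imp_subspace _ cl] K by metis
  have "(1/C) * norm x \<le> norm (S x)" if x: "x \<in> K" for x
  proof -
    obtain v where v: "v \<in> K" "S v = S x" "norm v \<le> C * norm (S x)" using C(2) x by blast
    have "x - v \<in> kernel_on K S"
      using K x v by (auto simp: kernel_on_def S.diff intro: complex_vector.subspace_diff)
    then have "v = x" using inj by auto
    then show ?thesis using v(3) C(1) by (simp add: field_simps)
  qed
  then show ?thesis using C(1) unfolding bounded_below_on_def by (intro exI[of _ "1/C"]) auto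
qed

text \<open>
  On a closed complement of its finite-dimensional kernel the operator is injective with unchanged,
  closed, range, so the open mapping theorem bounds it below there.
\<close>
lemma upper_semi_Fredholm_on_decompose:
  fixes S :: "'a::complex_banach \<Rightarrow> 'a"
  assumes S: "bounded_clinear S" and M: "closed_csubspace M" and usF: "upper_semi_Fredholm_on M S"
  obtains K where "closed_csubspace K" "K \<subseteq> M" "bounded_below_on K S" "M = subspace_sum K (kernel_on M S)"
proof -
  interpret S: bounded_linear S by (rule bounded_clinear_imp_bounded_linear[OF S])
  define F where "F = kernel_on M S"
  have sF: "csubspace F" and FM: "F \<subseteq> M" using csubspace_kernel_on[OF S] M by (auto simp: F_def kernel_on_def)
  have "finite_cdim F" using usF by (simp add: F_def upper_semi_Fredholm_on_def)
  then obtain B where B: "finite B" "F = cspan B" using sF by (rule finite_cdim_obtain_span)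
  obtain K0 where K0: "closed_csubspace K0" "K0 \<inter> F = {0}" "\<And>x. \<exists>k\<in>K0. x - k \<in> F"
    using finite_dim_closed_complement[OF B(1)] B(2) by blast
  define K where "K = K0 \<inter> M"
  have K: "closed_csubspace K" using K0(1) M by (auto simp: K_def complex_vector.subspace_inter)
  have sum: "M = subspace_sum K F"
  proof (intro equalityI subsetI)
    fix x assume x: "x \<in> M"
    obtain k where k: "k \<in> K0" "x - k \<in> F" using K0(3) by blast
    have "k \<in> K"
      using complex_vector.subspace_diff[OF conjunct1[OF M] x subsetD[OF FM k(2)]] k by (simp add: K_def)
    then show "x \<in> subspace_sum K F" using k by (intro CollectI exI[of _ k] exI[of _ "x - k"]) auto
  qed (use FM M in \<open>auto simp: K_def complex_vector.subspace_add\<close>)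
  have "S ` K = S ` M"
  proof (intro equalityI subsetI)
    fix y assume "y \<in> S ` M"
    then obtain k f where "y = S (k + f)" "k \<in> K" "f \<in> F" using sum by blast
    then show "y \<in> S ` K" by (simp add: S.add F_def kernel_on_def)
  qed (auto simp: K_def)
  then have "closed (S ` K)" using usF by (simp add: upper_semi_Fredholm_on_def)
  moreover have "kernel_on K S \<subseteq> {0}" using K0(2) by (auto simp: K_def F_def kernel_on_def)
  ultimately have "bounded_below_on K S" by (rule injective_closed_range_bounded_below[OF S K])
  moreover have "K \<subseteq> M" by (simp add: K_def)
  ultimately show ?thesis using that[OF K] sum unfolding F_def by blast
qed

lemma finite_cdim_image:
  assumes S: "bounded_clinear S" and F: "finite_cdim F"
  shows "finite_cdim (S ` F)"
proof -
  interpret S: bounded_linear S by (rule bounded_clinear_imp_bounded_linear[OF S])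
  obtain B where B: "finite B" "F \<subseteq> cspan B" using F by (auto simp: finite_cdim_def)
  have "S x \<in> cspan (S ` B)" if "x \<in> cspan B" for x
    using that
    by (induction rule: complex_vector.span_induct_alt)
       (auto simp: S.zero S.add bounded_clinear_scaleC[OF S]
          intro!: complex_vector.span_zero complex_vector.span_add complex_vector.span_scale intro: complex_vector.span_base)
  then show ?thesis unfolding finite_cdim_def using B by (intro exI[of _ "S ` B"]) auto
qed

text \<open>
  The converse of the decomposition: an operator that is bounded below on a closed subspace of finite
  codimension is upper semi-Fredholm. Since being bounded below survives small perturbations, the two
  together give stability under small shifts.
\<close>
lemma upper_semi_Fredholm_on_finite_extension:
  fixes S :: "'a::complex_banach \<Rightarrow> 'a"
  assumes S: "bounded_clinear S" and K: "closed_csubspace K" and F: "csubspace F" "finite_cdim F"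
    and b: "bounded_below_on K S"
  shows "upper_semi_Fredholm_on (subspace_sum K F) S"
proof -
  interpret S: bounded_linear S by (rule bounded_clinear_imp_bounded_linear[OF S])
  obtain c where c: "c > 0" "\<And>x. x \<in> K \<Longrightarrow> c * norm x \<le> norm (S x)" using b by (auto simp: bounded_below_on_def)
  obtain B where B: "finite B" "F = cspan B" by (rule finite_cdim_obtain_span[OF F(2,1)])
  define N where "N = kernel_on (subspace_sum K F) S"
  have "csubspace N" unfolding N_def
    using K F by (intro csubspace_kernel_on[OF S] complex_vector.subspace_sums) auto
  moreover have "N \<inter> K = {0}"
  proof -
    have "x = 0" if "x \<in> N" "x \<in> K" for x
      using that c(1) c(2)[of x] by (auto simp: N_def kernel_on_def mult_le_0_iff)
    then show ?thesis using complex_vector.subspace_0 \<open>csubspace N\<close> K by blast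
  qed
  moreover have "N \<subseteq> subspace_sum K (cspan B)" by (auto simp: N_def kernel_on_def B(2))
  ultimately have fd: "finite_cdim N"
    using finite_cdim_of_disjoint[OF B(1)] K by blast
  have "S ` (subspace_sum K F) = subspace_sum (S ` K) (S ` F)"
  proof (intro equalityI subsetI)
    fix y assume "y \<in> subspace_sum (S ` K) (S ` F)"
    then obtain k f where "y = S (k + f)" "k \<in> K" "f \<in> F" by (auto simp: S.add)
    then show "y \<in> S ` (subspace_sum K F)" by blast
  next
    fix y assume "y \<in> S ` (subspace_sum K F)"
    then obtain k f where "y = S k + S f" "k \<in> K" "f \<in> F" by (auto simp: S.add)
    then show "y \<in> subspace_sum (S ` K) (S ` F)" by blast
  qed
  moreover have "closed (subspace_sum (S ` K) (S ` F))"
    using F K by (intro closed_subspace_sum_finite_cdim conjI finite_cdim_image csubspace_image S bounded_below_closed_image b) auto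
  ultimately show ?thesis using fd by (simp add: upper_semi_Fredholm_on_def N_def)
qed

text \<open>
  The image of \<open>L\<close> does not change if the kernel is added to \<open>L\<close>. The enlarged space is still
  closed, and its image is that of its intersection with the subspace \<open>K\<close> where the operator is
  bounded below. Consequently all ranges \<open>(S ^^ n) ` M\<close> are closed, and the class passes to the
  summands of an invariant splitting.
\<close>
lemma upper_semi_Fredholm_on_closed_subspace:
  fixes S :: "'a::complex_banach \<Rightarrow> 'a"
  assumes S: "bounded_clinear S" and M: "closed_csubspace M" and usF: "upper_semi_Fredholm_on M S"
    and L: "closed_csubspace L" "L \<subseteq> M"
  shows "upper_semi_Fredholm_on L S"
proof -
  interpret S: bounded_linear S by (rule bounded_clinear_imp_bounded_linear[OF S])
  obtain K where K: "closed_csubspace K" "K \<subseteq> M" "bounded_below_on K S" "M = subspace_sum K (kernel_on M S)"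
    by (rule upper_semi_Fredholm_on_decompose[OF S M usF])
  define F where "F = kernel_on M S"
  have F: "csubspace F" "finite_cdim F"
    using csubspace_kernel_on[OF S] M usF by (auto simp: F_def upper_semi_Fredholm_on_def)
  have F0: "S f = 0" if "f \<in> F" for f using that by (simp add: F_def kernel_on_def)
  define G where "G = subspace_sum L F"
  have G: "closed_csubspace G" unfolding G_def
    using closed_subspace_sum_finite_cdim[OF F(2,1) L(1)] complex_vector.subspace_sums L(1) F(1) by blast
  have LG: "L \<subseteq> G" using complex_vector.subspace_0[OF F(1)] by (force simp: G_def)
  have FG: "F \<subseteq> G" using complex_vector.subspace_0[of L] L(1) by (force simp: G_def)
  have GK: "closed_csubspace (G \<inter> K)" using G K by (simp add: complex_vector.subspace_inter closed_Int)
  have "S ` L = S ` (G \<inter> K)"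
  proof (intro equalityI subsetI)
    fix y assume "y \<in> S ` L"
    then obtain x where x: "x \<in> L" "y = S x" by blast
    then obtain k f where kf: "x = k + f" "k \<in> K" "f \<in> F" using L(2) K(4) unfolding F_def by blast
    have "x - f \<in> G" using x kf LG FG G by (intro complex_vector.subspace_diff) auto
    then have "k \<in> G \<inter> K" using kf by simp
    then show "y \<in> S ` (G \<inter> K)" using x kf F0 by (auto simp: S.add)
  next
    fix y assume "y \<in> S ` (G \<inter> K)"
    then obtain l f where "y = S (l + f)" "l \<in> L" "f \<in> F" by (auto simp: G_def)
    then show "y \<in> S ` L" by (simp add: S.add F0)
  qed
  moreover have "closed (S ` (G \<inter> K))"
    using K(3) by (intro bounded_below_closed_image[OF S GK]) (auto simp: bounded_below_on_def)
  moreover have "finite_cdim (kernel_on L S)"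
    by (rule finite_cdim_subset[of "kernel_on M S"]) (use usF L(2) in \<open>auto simp: upper_semi_Fredholm_on_def kernel_on_def\<close>)
  ultimately show ?thesis by (simp add: upper_semi_Fredholm_on_def)
qed

lemma upper_semi_Fredholm_on_small_shift:
  fixes S :: "'a::complex_banach \<Rightarrow> 'a"
  assumes S: "bounded_clinear S" and M: "closed_csubspace M" and usF: "upper_semi_Fredholm_on M S"
  obtains e where "e > 0" "\<And>z. cmod z < e \<Longrightarrow> upper_semi_Fredholm_on M (shift_op S z)"
proof -
  obtain K where K: "closed_csubspace K" "K \<subseteq> M" "bounded_below_on K S" "M = subspace_sum K (kernel_on M S)"
    by (rule upper_semi_Fredholm_on_decompose[OF S M usF])
  obtain c where c: "c > 0" "\<And>x. x \<in> K \<Longrightarrow> c * norm x \<le> norm (S x)" using K(3) by (auto simp: bounded_below_on_def)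
  have "upper_semi_Fredholm_on M (shift_op S z)" if z: "cmod z < c" for z
  proof -
    have "(c - cmod z) * norm x \<le> norm (shift_op S z x)" if "x \<in> K" for x
      using c(2)[OF that] norm_triangle_ineq2[of "S x" "z *\<^sub>C x"]
      by (simp add: shift_op_def norm_scaleC left_diff_distrib)
    then have "bounded_below_on K (shift_op S z)" using z unfolding bounded_below_on_def
      by (intro exI[of _ "c - cmod z"]) auto
    then have "upper_semi_Fredholm_on (subspace_sum K (kernel_on M S)) (shift_op S z)"
      using usF M by (intro upper_semi_Fredholm_on_finite_extension bounded_clinear_shift_op S K csubspace_kernel_on)
        (auto simp: upper_semi_Fredholm_on_def)
    then show ?thesis using K(4) by simp
  qed
  then show ?thesis using c(1) that by blast
qed

section \<open>The hyperrange\<close>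

lemma bounded_clinear_funpow:
  assumes S: "bounded_clinear S" shows "bounded_clinear (S ^^ n)"
proof (induction n)
  case (Suc n)
  then show ?case using S by (auto simp: bounded_clinear_iff comp_def intro: bounded_linear_compose)
qed (simp add: bounded_clinear_iff id_def bounded_linear_ident)

definition hyperrange_on :: "'a set \<Rightarrow> ('a \<Rightarrow> 'a) \<Rightarrow> 'a set" where
  "hyperrange_on M S = (\<Inter>n. (S ^^ n) ` M)"

lemma funpow_image_invariant: "S ` M \<subseteq> M \<Longrightarrow> (S ^^ n) ` M \<subseteq> M"
  by (induction n) (auto simp: image_subset_iff)

lemma funpow_image_Suc: "(S ^^ Suc n) ` M = S ` ((S ^^ n) ` M)"
  by (simp add: image_comp)

lemma funpow_image_antimono:
  assumes "S ` M \<subseteq> M" "m \<le> n" shows "(S ^^ n) ` M \<subseteq> (S ^^ m) ` M"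
proof -
  have "(S ^^ n) ` M = (S ^^ m) ` ((S ^^ (n - m)) ` M)"
    using assms(2) by (simp add: image_comp flip: funpow_add)
  then show ?thesis using funpow_image_invariant[OF assms(1), of "n - m"] by auto
qed

lemma funpow_image_closed_csubspace:
  fixes S :: "'a::complex_banach \<Rightarrow> 'a"
  assumes S: "bounded_clinear S" and M: "closed_csubspace M" "S ` M \<subseteq> M" and usF: "upper_semi_Fredholm_on M S"
  shows "closed_csubspace ((S ^^ n) ` M)"
proof (induction n)
  case (Suc n)
  have "upper_semi_Fredholm_on ((S ^^ n) ` M) S"
    by (rule upper_semi_Fredholm_on_closed_subspace[OF S M(1) usF Suc funpow_image_invariant[OF M(2)]])
  then show ?case unfolding funpow_image_Suc
    using csubspace_image[OF S] Suc by (simp add: upper_semi_Fredholm_on_def)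
qed (use M in simp)

lemma hyperrange_closed_csubspace:
  fixes S :: "'a::complex_banach \<Rightarrow> 'a"
  assumes S: "bounded_clinear S" and M: "closed_csubspace M" "S ` M \<subseteq> M" and usF: "upper_semi_Fredholm_on M S"
  shows "closed_csubspace (hyperrange_on M S)"
  unfolding hyperrange_on_def
proof
  show "csubspace (\<Inter>n. (S ^^ n) ` M)"
    using funpow_image_closed_csubspace[OF assms] by (intro complex_vector.subspace_Inter) auto
  show "closed (\<Inter>n. (S ^^ n) ` M)"
    using funpow_image_closed_csubspace[OF assms] by (intro closed_INT) auto
qed

text \<open>
  A point of the hyperrange has a preimage in every \<open>(S ^^ n) ` M\<close>. Two such preimages differ by an
  element of \<open>kernel_on ((S ^^ n) ` M) S\<close>, and these finite-dimensional spaces are eventually constant;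
  from that index on, one preimage belongs to all the ranges.
\<close>
lemma hyperrange_image:
  fixes S :: "'a::complex_banach \<Rightarrow> 'a"
  assumes S: "bounded_clinear S" and M: "closed_csubspace M" "S ` M \<subseteq> M" and usF: "upper_semi_Fredholm_on M S"
  shows "S ` hyperrange_on M S = hyperrange_on M S"
proof (intro equalityI subsetI)
  interpret S: bounded_linear S by (rule bounded_clinear_imp_bounded_linear[OF S])
  define F where "F n = kernel_on ((S ^^ n) ` M) S" for n
  note R = funpow_image_closed_csubspace[OF assms]
  have sF: "csubspace (F n)" for n unfolding F_def using R by (intro csubspace_kernel_on S) auto
  have dF: "F n \<subseteq> F m" if "m \<le> n" for m n
    using funpow_image_antimono[OF M(2) that] by (auto simp: F_def kernel_on_def)
  have fF: "finite_cdim (F 0)" using usF by (simp add: F_def upper_semi_Fredholm_on_def)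
  obtain n0 where n0: "\<And>m. m \<ge> n0 \<Longrightarrow> F m = F n0"
    using decreasing_csubspaces_stabilize[of F, OF sF dF fF] by blast
  fix x assume x: "x \<in> hyperrange_on M S"
  have ex: "\<exists>y\<in>(S ^^ n) ` M. S y = x" for n
  proof -
    have "x \<in> (S ^^ Suc n) ` M" using x unfolding hyperrange_on_def by blast
    then show ?thesis unfolding funpow_image_Suc by blast
  qed
  obtain y where y: "y \<in> (S ^^ n0) ` M" "S y = x" using ex by blast
  have "y \<in> (S ^^ n) ` M" for n
  proof -
    define m where "m = max n n0"
    obtain z where z: "z \<in> (S ^^ m) ` M" "S z = x" using ex by blast
    have z0: "z \<in> (S ^^ n0) ` M" using z funpow_image_antimono[OF M(2), of n0 m] by (auto simp: m_def)
    have "y - z \<in> F n0"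
      using y z z0 R[of n0] by (auto simp: F_def kernel_on_def S.diff intro: complex_vector.subspace_diff)
    then have "y - z \<in> (S ^^ m) ` M" using n0[of m] by (auto simp: m_def F_def kernel_on_def)
    then have "(y - z) + z \<in> (S ^^ m) ` M" using z R[of m] by (intro complex_vector.subspace_add) auto
    then show ?thesis using funpow_image_antimono[OF M(2), of n m] by (auto simp: m_def)
  qed
  then show "x \<in> S ` hyperrange_on M S" using y by (auto simp: hyperrange_on_def)
next
  fix x assume "x \<in> S ` hyperrange_on M S"
  then obtain y where y: "y \<in> hyperrange_on M S" "x = S y" by blast
  have "x \<in> (S ^^ Suc n) ` M" for n
    unfolding funpow_image_Suc using y unfolding hyperrange_on_def by blast
  then have "x \<in> (S ^^ n) ` M" for n
    using funpow_image_antimono[OF M(2), of n "Suc n"] by (simp add: subset_iff)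
  then show "x \<in> hyperrange_on M S" by (simp add: hyperrange_on_def)
qed

section \<open>Invariant splittings and the removal of the nilpotent part\<close>

text \<open>
  The relation \<open>Red\<close> relative to a subspace \<open>M\<close> in place of the whole space, so that summands can be
  split again.
\<close>
definition invariant_splitting ::
    "('a::complex_normed_vector \<Rightarrow> 'a) \<Rightarrow> 'a set \<Rightarrow> 'a set \<Rightarrow> 'a set \<Rightarrow> bool" where
  "invariant_splitting S M A B \<longleftrightarrow>
     closed_csubspace A \<and> S ` A \<subseteq> A \<and> closed_csubspace B \<and> S ` B \<subseteq> B \<and>
     subspace_sum A B = M \<and> A \<inter> B = {0}"

lemma invariant_splitting_UNIV_iff_Red: "invariant_splitting S UNIV A B \<longleftrightarrow> (A, B) \<in> Red S"
  by (auto simp: invariant_splitting_def Red_def)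

lemma invariant_splitting_subset:
  assumes "invariant_splitting S M A B" shows "A \<subseteq> M" "B \<subseteq> M"
proof -
  have A: "0 \<in> A" and B: "0 \<in> B" and M: "M = subspace_sum A B"
    using assms by (auto simp: invariant_splitting_def)
  show "A \<subseteq> M" unfolding M using B by force
  show "B \<subseteq> M" unfolding M using A by force
qed

text \<open>
  Moves a finite-dimensional invariant summand \<open>C\<close> from \<open>A\<close> over to \<open>B\<close>. Finite dimension is what
  keeps the sum of \<open>C\<close> and \<open>B\<close> closed.
\<close>
lemma invariant_splitting_assoc:
  assumes S: "bounded_clinear S" and 1: "invariant_splitting S M A B" and 2: "invariant_splitting S A A' C" and fd: "finite_cdim C"
  shows "invariant_splitting S M A' (subspace_sum C B)" "invariant_splitting S (subspace_sum C B) C B"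
proof -
  interpret S: bounded_linear S by (rule bounded_clinear_imp_bounded_linear[OF S])
  define D where "D = subspace_sum C B"
  have A: "csubspace A" "closed A" "A \<inter> B = {0}" "M = subspace_sum A B" "S ` B \<subseteq> B" "csubspace B" "closed B"
    using 1 by (auto simp: invariant_splitting_def)
  have A': "csubspace A'" "closed A'" "A' \<inter> C = {0}" "A = subspace_sum A' C" "S ` C \<subseteq> C" "S ` A' \<subseteq> A'" "csubspace C" "closed C"
    using 2 by (auto simp: invariant_splitting_def)
  have CA: "C \<subseteq> A" "A' \<subseteq> A" using invariant_splitting_subset[OF 2] by auto
  have D: "csubspace D" unfolding D_def by (intro complex_vector.subspace_sums A A')
  have D_alt: "D = subspace_sum B C" unfolding D_def by (metis (no_types, opaque_lifting) add.commute)
  have "closed D" unfolding D_alt using A A' fd by (intro closed_subspace_sum_finite_cdim) auto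
  moreover have "S ` D \<subseteq> D"
  proof
    fix y assume "y \<in> S ` D"
    then obtain c b where "y = S c + S b" "c \<in> C" "b \<in> B" by (auto simp: D_def S.add)
    moreover have "S c \<in> C" "S b \<in> B" using calculation A A' by auto
    ultimately show "y \<in> D" unfolding D_def by blast
  qed
  moreover have "subspace_sum A' D = M"
  proof (intro equalityI subsetI)
    fix x assume "x \<in> subspace_sum A' D"
    then obtain a c b where x: "x = a + (c + b)" "a \<in> A'" "c \<in> C" "b \<in> B" unfolding D_def by blast
    have "a + c \<in> A" unfolding A'(4) using x by blast
    moreover have "x = (a + c) + b" using x by (simp add: add.assoc)
    ultimately show "x \<in> M" unfolding A(4) using x by blast
  next
    fix x assume "x \<in> M"
    then obtain y b where y: "x = y + b" "y \<in> A" "b \<in> B" unfolding A(4) by blast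
    then obtain a c where ac: "y = a + c" "a \<in> A'" "c \<in> C" unfolding A'(4) by blast
    have "c + b \<in> D" unfolding D_def using ac y by blast
    moreover have "x = a + (c + b)" using ac y by (simp add: add.assoc)
    ultimately show "x \<in> subspace_sum A' D" using ac by blast
  qed
  moreover have "A' \<inter> D = {0}"
  proof -
    have "x = 0" if x: "x \<in> A'" "x \<in> D" for x
    proof -
      obtain c b where cb: "x = c + b" "c \<in> C" "b \<in> B" using x(2) unfolding D_def by blast
      have "x - c \<in> A" using x cb CA A(1) by (intro complex_vector.subspace_diff) auto
      then have "b \<in> A \<inter> B" using cb by simp
      then have "b = 0" using A(3) by blast
      then have "x \<in> A' \<inter> C" using x cb by simp
      then show ?thesis using A'(3) by blast
    qed
    then show ?thesis using complex_vector.subspace_0[OF D] complex_vector.subspace_0[OF A'(1)] by blast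
  qed
  ultimately show "invariant_splitting S M A' (subspace_sum C B)"
    using A' D unfolding invariant_splitting_def D_def by blast
  have "C \<inter> B = {0}" using CA A(3) complex_vector.subspace_0[OF A'(7)] complex_vector.subspace_0[OF A(6)] by blast
  then show "invariant_splitting S (subspace_sum C B) C B" using A A' unfolding invariant_splitting_def by blast
qed

lemma funpow_vanishes_on_cspan:
  assumes S: "bounded_clinear S" and "\<And>b. b \<in> B \<Longrightarrow> (S ^^ n) b = 0" and "y \<in> cspan B"
  shows "(S ^^ n) y = 0"
proof -
  have "cspan B \<subseteq> kernel_on UNIV (S ^^ n)"
    using assms(2) by (intro complex_vector.span_minimal csubspace_kernel_on bounded_clinear_funpow S)
      (auto simp: kernel_on_def complex_vector.subspace_UNIV)
  then show ?thesis using assms(3) by (auto simp: kernel_on_def)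
qed

text \<open>
  Let \<open>n\<close> be maximal with \<open>x0\<close> in the range of \<open>S ^^ n\<close>, say \<open>x0 = (S ^^ n) u\<close>. Then \<open>B\<close>, the span of
  \<open>u, S u, \<dots>, (S ^^ n) u = x0\<close>, is a single Jordan block. As the range of \<open>S ^^ Suc n\<close> is closed and
  misses \<open>x0\<close>, there is a functional \<open>\<phi>\<close> that vanishes on it with \<open>\<phi> x0 = 1\<close>. The complement \<open>A\<close>
  is the common kernel of all \<open>\<phi> \<circ> (S ^^ i)\<close>: it is invariant by construction, and the functionals
  with \<open>i \<le> n\<close> are dual to the block up to a triangular matrix with unit diagonal.
\<close>
lemma Jordan_block_splits_off:
  fixes S :: "'a::complex_banach \<Rightarrow> 'a"
  assumes S: "bounded_clinear S" and M: "closed_csubspace M" "S ` M \<subseteq> M" and usF: "upper_semi_Fredholm_on M S"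
    and x0: "x0 \<in> kernel_on M S" "x0 \<notin> hyperrange_on M S"
  obtains A B n where "invariant_splitting S M A B" "x0 \<in> B" "finite_cdim B" "\<forall>y\<in>B. (S ^^ n) y = 0"
proof -
  interpret S: bounded_linear S by (rule bounded_clinear_imp_bounded_linear[OF S])
  note R = funpow_image_closed_csubspace[OF S M usF]
  have pow: "bounded_clinear (S ^^ i)" for i by (rule bounded_clinear_funpow[OF S])
  have x0M: "x0 \<in> M" "S x0 = 0" using x0(1) by (auto simp: kernel_on_def)
  obtain n where n: "x0 \<in> (S ^^ n) ` M" "x0 \<notin> (S ^^ Suc n) ` M"
  proof -
    have "\<exists>m. x0 \<notin> (S ^^ m) ` M" using x0(2) unfolding hyperrange_on_def by blast
    then obtain m where m: "x0 \<notin> (S ^^ m) ` M" "\<And>k. k < m \<Longrightarrow> x0 \<in> (S ^^ k) ` M"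
      using exists_least_iff[of "\<lambda>m. x0 \<notin> (S ^^ m) ` M"] by blast
    then show ?thesis using x0M(1) that[of "m - 1"] by (cases m) auto
  qed
  obtain \<phi> where \<phi>: "bounded_cfunctional \<phi>" "\<forall>v\<in>(S ^^ Suc n) ` M. \<phi> v = 0" "\<phi> x0 = 1"
    using R[of "Suc n"] n(2) by (metis complex_functional_separating)
  note \<phi>_bl = bounded_cfunctionalD(1)[OF \<phi>(1)] and \<phi>_sc = bounded_cfunctionalD(2)[OF \<phi>(1)]
  interpret \<phi>: bounded_linear \<phi> by (rule \<phi>_bl)
  have \<phi>0: "\<phi> ((S ^^ i) x) = 0" if "x \<in> M" "i > n" for x i
    using \<phi>(2) funpow_image_antimono[OF M(2), of "Suc n" i] that by (metis Suc_leI image_eqI subsetD)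
  obtain u where u: "u \<in> M" "x0 = (S ^^ n) u" using n(1) by blast
  define e where "e i = (S ^^ i) u" for i
  have eM: "e i \<in> M" for i using funpow_image_invariant[OF M(2), of i] u(1) by (auto simp: e_def)
  have en: "e n = x0" by (simp add: e_def u(2))
  have Se: "(S ^^ i) (e j) = e (i + j)" for i j by (simp add: e_def funpow_add)
  have e0: "e i = 0" if "i > n" for i
  proof -
    have "e (Suc n) = 0" using en x0M(2) by (simp add: e_def)
    then have "e i = (S ^^ (i - Suc n)) 0" using Se[of "i - Suc n" "Suc n"] that by simp
    then show ?thesis using bounded_linear.linear[OF bounded_clinear_imp_bounded_linear[OF pow]] by (simp add: linear_0)
  qed
  define A where "A = {x\<in>M. \<forall>i. \<phi> ((S ^^ i) x) = 0}"
  define B where "B = cspan (range e)"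
  have A_inv: "S ` A \<subseteq> A"
  proof
    fix y assume "y \<in> S ` A"
    then obtain x where x: "y = S x" "x \<in> A" by blast
    have "\<phi> ((S ^^ i) y) = 0" for i
    proof -
      have "\<phi> ((S ^^ Suc i) x) = 0" using x(2) unfolding A_def by blast
      then show ?thesis by (simp add: x(1) funpow_swap1)
    qed
    then show "y \<in> A" using x M(2) by (auto simp: A_def)
  qed
  have A_sub: "csubspace A"
  proof -
    have "csubspace {x. \<phi> ((S ^^ i) x) = 0}" for i
    proof -
      interpret p: bounded_linear "S ^^ i" by (rule bounded_clinear_imp_bounded_linear[OF pow])
      show ?thesis
        by (rule complex_vector.subspaceI)
          (auto simp: p.zero p.add bounded_clinear_scaleC[OF pow] \<phi>.zero \<phi>.add \<phi>_sc)
    qed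
    then have "csubspace (M \<inter> (\<Inter>i. {x. \<phi> ((S ^^ i) x) = 0}))"
      using M(1) by (intro complex_vector.subspace_inter complex_vector.subspace_Inter) auto
    also have "M \<inter> (\<Inter>i. {x. \<phi> ((S ^^ i) x) = 0}) = A" by (auto simp: A_def)
    finally show ?thesis .
  qed
  have A_closed: "closed A"
  proof -
    have "closed {x. \<phi> ((S ^^ i) x) = 0}" for i
    proof -
      have "closed ((\<lambda>x. \<phi> ((S ^^ i) x)) -` {0})"
        by (intro closed_vimage closed_singleton linear_continuous_on bounded_linear_compose[OF \<phi>_bl]
            bounded_clinear_imp_bounded_linear pow)
      then show ?thesis by (simp add: vimage_def)
    qed
    then have "closed (M \<inter> (\<Inter>i. {x. \<phi> ((S ^^ i) x) = 0}))"
      using M(1) by (intro closed_Int closed_INT) auto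
    also have "M \<inter> (\<Inter>i. {x. \<phi> ((S ^^ i) x) = 0}) = A" by (auto simp: A_def)
    finally show ?thesis .
  qed
  have B_sub: "csubspace B" unfolding B_def by (rule complex_vector.subspace_span)
  have B_M: "B \<subseteq> M" unfolding B_def using M(1) eM by (intro complex_vector.span_minimal) auto
  have eB: "e i \<in> B" for i unfolding B_def by (intro complex_vector.span_base) auto
  have B_fd: "finite_cdim B"
  proof -
    have "range e \<subseteq> insert 0 (e ` {..n})" using e0 by (auto simp: not_le) (metis atMost_iff image_eqI not_le)
    then have "B \<subseteq> cspan (insert 0 (e ` {..n}))" unfolding B_def by (rule complex_vector.span_mono)
    moreover have "finite (insert 0 (e ` {..n}))" by simp
    ultimately show ?thesis unfolding finite_cdim_def by (intro exI conjI)
  qed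
  have B_inv: "S ` B \<subseteq> B"
  proof
    fix y assume "y \<in> S ` B"
    then obtain x where x: "y = S x" "x \<in> cspan (range e)" by (auto simp: B_def)
    from x(2) have "S x \<in> B"
    proof (induction rule: complex_vector.span_induct_alt)
      case base
      then show ?case using complex_vector.subspace_0[OF B_sub] by (simp add: S.zero)
    next
      case (step c b y)
      then obtain i where "b = e i" by blast
      then have "S b = e (Suc i)" by (simp add: e_def)
      then show ?case using step B_sub eB
        by (simp add: S.add bounded_clinear_scaleC[OF S] complex_vector.subspace_add complex_vector.subspace_scale)
    qed
    then show "y \<in> B" by (simp add: x(1))
  qed
  have nil: "(S ^^ Suc n) y = 0" if "y \<in> B" for y
    by (rule funpow_vanishes_on_cspan[OF S, of "range e"]) (use that Se e0 B_def in \<open>auto simp del: funpow.simps\<close>)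
  have int: "A \<inter> B = {0}"
  proof -
    have "y = 0" if y: "y \<in> A" "y \<in> B" for y
    proof -
      \<comment> \<open>The functional \<open>\<phi> \<circ> (S ^^ (n - k))\<close> is 1 at \<open>e k\<close> and 0 at all later vectors;
        since it vanishes at \<open>y\<close>, the coefficient of \<open>e k\<close> is 0.\<close>
      have "k \<le> Suc n \<Longrightarrow> y \<in> cspan (e ` {k..})" for k
      proof (induction k)
        case 0
        then show ?case using y(2) by (simp add: B_def atLeast_0)
      next
        case (Suc k)
        have "e ` {k..} = insert (e k) (e ` {Suc k..})" by (metis atLeast_Suc_greaterThan image_insert ivl_disj_un_singleton(1) insert_is_Un)
        then obtain c where c: "y - c *\<^sub>C e k \<in> cspan (e ` {Suc k..})"
          using Suc by (auto simp: complex_vector.span_insert)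
        interpret p: bounded_linear "S ^^ (n - k)" by (rule bounded_clinear_imp_bounded_linear[OF pow])
        have "(S ^^ (n - k)) (y - c *\<^sub>C e k) = 0"
          by (rule funpow_vanishes_on_cspan[OF S _ c]) (use Suc.prems Se e0 in auto)
        then have "(S ^^ (n - k)) y = c *\<^sub>C x0"
          using Suc.prems by (simp add: p.diff bounded_clinear_scaleC[OF pow] Se en)
        then have "\<phi> (c *\<^sub>C x0) = 0" using y(1) by (metis (mono_tags, lifting) A_def mem_Collect_eq)
        then have "c = 0" by (simp add: \<phi>_sc \<phi>(3))
        then show ?case using c by simp
      qed
      from this[of "Suc n"] have "y \<in> cspan (e ` {Suc n..})" by simp
      moreover have "cspan (e ` {Suc n..}) \<subseteq> {0}"
        using e0 by (intro complex_vector.span_minimal complex_vector.subspace_single_0) auto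
      ultimately show ?thesis by blast
    qed
    then show ?thesis using complex_vector.subspace_0[OF A_sub] complex_vector.subspace_0[OF B_sub] by blast
  qed
  have sum: "subspace_sum A B = M"
  proof (intro equalityI subsetI)
    fix x assume "x \<in> subspace_sum A B"
    then obtain a b where "x = a + b" "a \<in> M" "b \<in> M" using B_M by (auto simp: A_def)
    then show "x \<in> M" using M(1) by (simp add: complex_vector.subspace_add)
  next
    fix x assume x: "x \<in> M"
    \<comment> \<open>The triangular system for the component in \<open>B\<close>, solved from the highest power downwards.\<close>
    have "k \<le> Suc n \<Longrightarrow> \<exists>y\<in>B. \<forall>i\<ge>Suc n - k. \<phi> ((S ^^ i) (x - y)) = 0" for k
    proof (induction k)
      case 0
      have "\<phi> ((S ^^ i) (x - 0)) = 0" if "i \<ge> Suc n" for i using \<phi>0[OF x, of i] that by simp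
      then show ?case using complex_vector.subspace_0[OF B_sub] by (intro bexI[of _ 0]) auto
    next
      case (Suc k)
      then obtain y where y: "y \<in> B" "\<And>i. i \<ge> Suc n - k \<Longrightarrow> \<phi> ((S ^^ i) (x - y)) = 0" by auto
      define c where "c = \<phi> ((S ^^ (n - k)) (x - y))"
      define y' where "y' = y + c *\<^sub>C e k"
      have "\<phi> ((S ^^ i) (x - y')) = 0" if i: "i \<ge> Suc n - Suc k" for i
      proof -
        interpret p: bounded_linear "S ^^ i" by (rule bounded_clinear_imp_bounded_linear[OF pow])
        have xy: "x - y' = (x - y) - c *\<^sub>C e k" by (simp add: y'_def)
        have "(S ^^ i) (x - y') = (S ^^ i) (x - y) - c *\<^sub>C e (i + k)"
          unfolding xy by (subst p.diff) (simp only: bounded_clinear_scaleC[OF pow] Se)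
        then have *: "\<phi> ((S ^^ i) (x - y')) = \<phi> ((S ^^ i) (x - y)) - c * \<phi> (e (i + k))"
          by (simp only: \<phi>.diff \<phi>_sc)
        show ?thesis
        proof (cases "i = n - k")
          case True
          then show ?thesis using * Suc.prems by (simp add: c_def en \<phi>(3))
        next
          case False
          then show ?thesis using * y(2)[of i] e0[of "i + k"] i Suc.prems by (simp add: \<phi>.zero)
        qed
      qed
      moreover have "y' \<in> B" unfolding y'_def using B_sub y(1) eB
        by (intro complex_vector.subspace_add complex_vector.subspace_scale)
      ultimately show ?case by blast
    qed
    from this[of "Suc n"] obtain y where y: "y \<in> B" "\<And>i. \<phi> ((S ^^ i) (x - y)) = 0" by auto
    have "x - y \<in> A" using y x B_M M(1) by (auto simp: A_def intro: complex_vector.subspace_diff)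
    then show "x \<in> subspace_sum A B" using y(1) by (intro CollectI exI[of _ "x - y"] exI[of _ y]) auto
  qed
  show ?thesis
  proof (rule that)
    show "invariant_splitting S M A B"
      using A_sub A_closed A_inv B_sub B_inv int sum closed_finite_cdim[OF B_fd B_sub] unfolding invariant_splitting_def by blast
    show "x0 \<in> B" using eB[of n] en by simp
    show "\<forall>y\<in>B. (S ^^ Suc n) y = 0" using nil by blast
  qed (rule B_fd)
qed

text \<open>
  Every nonzero vector of the kernel lies outside the hyperrange, hence in a Jordan block that can be
  split off; this lowers the dimension of the kernel. When the kernel is gone, the remaining operator
  is injective with closed range.
\<close>
lemma upper_semi_Fredholm_nilpotent_splitting:
  fixes S :: "'a::complex_banach \<Rightarrow> 'a"
  assumes S: "bounded_clinear S" and M: "closed_csubspace M" "S ` M \<subseteq> M" and usF: "upper_semi_Fredholm_on M S"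
    and ker: "kernel_on M S \<inter> hyperrange_on M S \<subseteq> {0}"
  shows "\<exists>A B n. invariant_splitting S M A B \<and> bounded_below_on A S \<and> finite_cdim B \<and> (\<forall>y\<in>B. (S ^^ n) y = 0)"
  using M usF ker
proof (induction "complex_vector.dim (kernel_on M S)" arbitrary: M rule: less_induct)
  case less
  show ?case
  proof (cases "kernel_on M S \<subseteq> {0}")
    case True
    have "bounded_below_on M S"
      using less.prems True by (intro injective_closed_range_bounded_below S) (auto simp: upper_semi_Fredholm_on_def)
    moreover have "invariant_splitting S M M {0}"
      using less.prems complex_vector.subspace_single_0 complex_vector.subspace_0[of M]
        bounded_linear.linear[OF bounded_clinear_imp_bounded_linear[OF S]]
      by (auto simp: invariant_splitting_def linear_0)
    moreover have "finite_cdim {0::'a}"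
      unfolding finite_cdim_def by (intro exI[of _ "{}"]) auto
    ultimately show ?thesis by (intro exI[of _ M] exI[of _ "{0}"] exI[of _ 0]) auto
  next
    case False
    then obtain x0 where x0: "x0 \<in> kernel_on M S" "x0 \<noteq> 0" by blast
    then have "x0 \<notin> hyperrange_on M S" using less.prems by blast
    then obtain A B n where AB: "invariant_splitting S M A B" "x0 \<in> B" "finite_cdim B" "\<forall>y\<in>B. (S ^^ n) y = 0"
      using Jordan_block_splits_off[OF S less.prems(1-3) x0(1)] by metis
    have A: "closed_csubspace A" "S ` A \<subseteq> A" "A \<inter> B = {0}" "csubspace B" using AB(1) by (auto simp: invariant_splitting_def)
    have AM: "A \<subseteq> M" by (rule invariant_splitting_subset[OF AB(1)])
    have kA: "kernel_on A S \<subseteq> kernel_on M S" using AM by (auto simp: kernel_on_def)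
    have "x0 \<notin> kernel_on A S" using A(3) AB(2) x0(2) by (auto simp: kernel_on_def)
    then have psub: "kernel_on A S \<subset> kernel_on M S" using kA x0(1) by blast
    have "hyperrange_on A S \<subseteq> hyperrange_on M S" using AM by (fastforce simp: hyperrange_on_def)
    then have ker: "kernel_on A S \<inter> hyperrange_on A S \<subseteq> {0}" using kA less.prems(4) by blast
    have usA: "upper_semi_Fredholm_on A S"
      by (rule upper_semi_Fredholm_on_closed_subspace[OF S less.prems(1,3) A(1) AM])
    have "complex_vector.dim (kernel_on A S) < complex_vector.dim (kernel_on M S)"
      using less.prems(3) A by (intro dim_strict_mono_finite_cdim[OF _ _ psub] csubspace_kernel_on S)
        (auto simp: upper_semi_Fredholm_on_def)
    from less.hyps[OF this A(1,2) usA ker] obtain A' C m where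
      C: "invariant_splitting S A A' C" "bounded_below_on A' S" "finite_cdim C" "\<forall>y\<in>C. (S ^^ m) y = 0" by blast
    have sC: "csubspace C" using C(1) by (auto simp: invariant_splitting_def)
    have "finite_cdim (subspace_sum C B)"
    proof -
      obtain B1 where B1: "finite B1" "B = cspan B1" by (rule finite_cdim_obtain_span[OF AB(3) A(4)])
      obtain C1 where C1: "finite C1" "C = cspan C1" by (rule finite_cdim_obtain_span[OF C(3) sC])
      have "subspace_sum C B \<subseteq> cspan (C1 \<union> B1)" unfolding B1 C1 by (auto simp: complex_vector.span_Un)
      moreover have "finite (C1 \<union> B1)" using B1 C1 by simp
      ultimately show ?thesis unfolding finite_cdim_def by (intro exI conjI)
    qed
    moreover have "(S ^^ (m + n)) y = 0" if y: "y \<in> subspace_sum C B" for y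
    proof -
      obtain c b where y: "y = c + b" "c \<in> C" "b \<in> B" using y by blast
      have z: "(S ^^ k) 0 = 0" for k
        using bounded_linear.linear[OF bounded_clinear_imp_bounded_linear[OF bounded_clinear_funpow[OF S]]] by (simp add: linear_0)
      have "(S ^^ (m + n)) b = (S ^^ m) ((S ^^ n) b)" by (simp add: funpow_add)
      moreover have "(S ^^ (m + n)) c = (S ^^ n) ((S ^^ m) c)" by (simp add: funpow_add add.commute[of m n])
      ultimately show ?thesis
        using AB(4) C(4) y linear_add[OF bounded_linear.linear[OF bounded_clinear_imp_bounded_linear[OF bounded_clinear_funpow[OF S]]], of "m + n" c b]
        by (simp add: z)
    qed
    ultimately show ?thesis using invariant_splitting_assoc(1)[OF S AB(1) C(1,3)] C(2) by blast
  qed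
qed

section \<open>The single valued extension property\<close>

text \<open>
  An analytic solution of the eigenvector equation vanishes near \<open>z\<close>, except possibly at \<open>z\<close>. The
  identity theorem is scalar, so a value \<open>f w \<noteq> 0\<close> is first detected by a bounded functional.
\<close>
lemma SVEP_at_of_punctured_injective:
  fixes T :: "'a::complex_banach \<Rightarrow> 'a"
  assumes e: "e > 0" and inj: "\<And>w x. 0 < cmod w \<Longrightarrow> cmod w < e \<Longrightarrow> shift_op (shift_op T z) w x = 0 \<Longrightarrow> x = 0"
  shows "SVEP_at T z"
  unfolding SVEP_at_def
proof (intro allI impI ballI)
  fix U f w
  assume U: "open U \<and> connected U \<and> z \<in> U"
    and f: "vector_analytic_on f U \<and> (\<forall>z\<in>U. shift_op T z (f z) = 0)" and w: "w \<in> U"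
  show "f w = 0"
  proof (rule ccontr)
    assume "f w \<noteq> 0"
    then obtain \<phi> where \<phi>: "bounded_cfunctional \<phi>" "\<phi> (f w) = 1" by (rule complex_functional_nonzero)
    note \<phi>_bl = bounded_cfunctionalD(1)[OF \<phi>(1)] and \<phi>_sc = bounded_cfunctionalD(2)[OF \<phi>(1)]
    have hol: "(\<lambda>\<zeta>. \<phi> (f \<zeta>)) holomorphic_on U"
      unfolding holomorphic_on_def
    proof
      fix \<zeta> assume "\<zeta> \<in> U"
      then obtain d where "(f has_derivative (\<lambda>h. h *\<^sub>C d)) (at \<zeta>)" using f unfolding vector_analytic_on_def by blast
      then have "((\<lambda>\<zeta>. \<phi> (f \<zeta>)) has_derivative (\<lambda>h. \<phi> (h *\<^sub>C d))) (at \<zeta>)"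
        by (rule bounded_linear.has_derivative[OF \<phi>_bl])
      moreover have "(\<lambda>h. \<phi> (h *\<^sub>C d)) = (*) (\<phi> d)" by (auto simp: \<phi>_sc mult.commute)
      ultimately have "((\<lambda>\<zeta>. \<phi> (f \<zeta>)) has_field_derivative \<phi> d) (at \<zeta>)"
        by (simp add: has_field_derivative_def)
      then show "(\<lambda>\<zeta>. \<phi> (f \<zeta>)) field_differentiable (at \<zeta> within U)"
        using field_differentiable_def field_differentiable_at_within by blast
    qed
    define V where "V = (ball z e \<inter> U) - {z}"
    have "z \<in> interior (ball z e \<inter> U)" using U e by (simp add: interior_open open_Int)
    then have lim: "z islimpt V" unfolding V_def by (simp add: islimpt_punctured[symmetric] interior_limit_point)
    have zero: "\<phi> (f \<zeta>) = 0" if "\<zeta> \<in> V" for \<zeta>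
    proof -
      have "shift_op (shift_op T z) (\<zeta> - z) (f \<zeta>) = 0" using f that by (simp add: shift_op_shift_op V_def)
      moreover have "0 < cmod (\<zeta> - z)" "cmod (\<zeta> - z) < e"
        using that by (auto simp: V_def dist_norm norm_minus_commute)
      ultimately have "f \<zeta> = 0" using inj by metis
      then show ?thesis using bounded_linear.linear[OF \<phi>_bl] by (simp add: linear_0)
    qed
    have "\<phi> (f w) = 0"
      by (rule analytic_continuation[OF hol _ _ _ _ lim zero w]) (use U in \<open>auto simp: V_def\<close>)
    then show False using \<phi>(2) by simp
  qed
qed

text \<open>
  If \<open>x\<close> is a backward orbit of \<open>S\<close> that starts in the kernel and grows at most geometrically, then
  \<open>g w\<close>, the sum of \<open>w ^ n *\<^sub>C x n\<close>, satisfies \<open>S (g w) = w *\<^sub>C g w\<close>: applying \<open>S\<close> shifts the series by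
  one place.
\<close>
lemma power_series_eigenvectors:
  fixes x :: "nat \<Rightarrow> 'a::complex_banach"
  assumes S: "bounded_clinear S" and x0: "S (x 0) = 0" and xS: "\<And>n. S (x (Suc n)) = x n"
    and C: "C > 0" and bd: "\<And>n. norm (x n) \<le> C ^ n * K"
  obtains g r where "r > 0" "g 0 = x 0" "vector_analytic_on g (ball 0 r)"
    "\<And>w. w \<in> ball 0 r \<Longrightarrow> shift_op S w (g w) = 0"
proof -
  interpret S: bounded_linear S by (rule bounded_clinear_imp_bounded_linear[OF S])
  \<comment> \<open>This radius makes the differentiated series dominated by \<open>n / 2 ^ (n - 1)\<close>, up to a constant factor.\<close>
  define r where "r = 1 / (2 * C)"
  have r: "r > 0" using C by (simp add: r_def)
  define d where "d w = (\<Sum>n. (of_nat n * w ^ (n - 1)) *\<^sub>C x n)" for w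
  have K: "K \<ge> 0" using bd[of 0] norm_ge_zero[of "x 0"] by (simp del: norm_ge_zero)
  have unif: "uniform_limit (ball 0 r) (\<lambda>n w. \<Sum>i<n. (of_nat i * w ^ (i - 1)) *\<^sub>C x i) d sequentially"
    unfolding d_def
  proof (rule Weierstrass_m_test)
    fix n and w :: complex assume w: "w \<in> ball 0 r"
    show "norm ((of_nat n * w ^ (n - 1)) *\<^sub>C x n) \<le> real n * (1/2) ^ (n - 1) * (C * K)"
    proof (cases n)
      case (Suc m)
      have "cmod w ^ m \<le> r ^ m" using w by (intro power_mono) auto
      then have "real n * cmod w ^ m * norm (x n) \<le> real n * r ^ m * (C ^ n * K)"
        using bd[of n] r by (intro mult_mono) auto
      also have "\<dots> = real n * (r * C) ^ m * (C * K)" by (simp add: Suc power_mult_distrib)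
      also have "r * C = 1/2" using C by (simp add: r_def)
      finally have le: "real n * cmod w ^ m * norm (x n) \<le> real n * (1/2) ^ m * (C * K)" .
      have "n - 1 = m" using Suc by simp
      then show ?thesis using le by (simp only: norm_scaleC norm_mult norm_power norm_of_nat)
    qed (simp add: K)
  next
    have "summable (\<lambda>n. real (Suc n) * (1/2) ^ n)"
      using geometric_deriv_sums[of "1/2::real"] by (auto intro: sums_summable)
    then have "summable (\<lambda>n. real n * (1/2) ^ (n - 1))"
      by (subst summable_Suc_iff[symmetric]) simp
    then show "summable (\<lambda>n. real n * (1/2) ^ (n - 1) * (C * K))" by (rule summable_mult2)
  qed
  have "\<exists>g. \<forall>w\<in>ball 0 r. (\<lambda>n. w ^ n *\<^sub>C x n) sums (g w) \<and> (g has_derivative (\<lambda>h. h *\<^sub>C d w)) (at w within ball 0 r)"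
  proof (rule has_derivative_series)
    show "convex (ball (0::complex) r)" by simp
    show "((\<lambda>w. w ^ n *\<^sub>C x n) has_derivative (\<lambda>h. h *\<^sub>C ((of_nat n * w ^ (n - 1)) *\<^sub>C x n))) (at w within ball 0 r)" for n w
    proof -
      have "((\<lambda>w. w ^ n) has_derivative (\<lambda>h. h * (of_nat n * w ^ (n - 1)))) (at w within ball 0 r)"
        by (auto intro!: derivative_eq_intros)
      then have "((\<lambda>w. w ^ n *\<^sub>C x n) has_derivative (\<lambda>h. (h * (of_nat n * w ^ (n - 1))) *\<^sub>C x n)) (at w within ball 0 r)"
        by (rule bounded_linear.has_derivative[OF bounded_linear_scaleC_left])
      then show ?thesis by (simp add: scaleC_scaleC)
    qed
    show "\<forall>\<^sub>F n in sequentially. \<forall>w\<in>ball 0 r. \<forall>h.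
        norm ((\<Sum>i<n. h *\<^sub>C ((of_nat i * w ^ (i - 1)) *\<^sub>C x i)) - h *\<^sub>C d w) \<le> e * norm h" if e: "e > 0" for e
      using uniform_limitD[OF unif e]
    proof eventually_elim
      case (elim n)
      show ?case
      proof (intro ballI allI)
        fix w h :: complex assume w: "w \<in> ball 0 r"
        have "norm ((\<Sum>i<n. h *\<^sub>C ((of_nat i * w ^ (i - 1)) *\<^sub>C x i)) - h *\<^sub>C d w)
            = cmod h * norm ((\<Sum>i<n. (of_nat i * w ^ (i - 1)) *\<^sub>C x i) - d w)"
          by (simp add: complex_vector.scale_sum_right complex_vector.scale_right_diff_distrib flip: norm_scaleC)
        also have "\<dots> \<le> cmod h * e" using elim w by (intro mult_left_mono) (auto simp: dist_norm intro: less_imp_le)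
        finally show "norm ((\<Sum>i<n. h *\<^sub>C ((of_nat i * w ^ (i - 1)) *\<^sub>C x i)) - h *\<^sub>C d w) \<le> e * norm h"
          by (simp add: mult.commute)
      qed
    qed
    show "0 \<in> ball (0::complex) r" using r by simp
    show "(\<lambda>n. 0 ^ n *\<^sub>C x n) sums x 0"
      using sums_single[of 0 x] by (rule sums_cong[THEN iffD1, rotated]) (auto simp: power_0_left)
  qed
  then obtain g where g: "\<And>w. w \<in> ball 0 r \<Longrightarrow> (\<lambda>n. w ^ n *\<^sub>C x n) sums (g w)"
    "\<And>w. w \<in> ball 0 r \<Longrightarrow> (g has_derivative (\<lambda>h. h *\<^sub>C d w)) (at w within ball 0 r)" by blast
  show ?thesis
  proof (rule that[OF r])
    have "(\<lambda>n. 0 ^ n *\<^sub>C x n) sums x 0"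
      using sums_single[of 0 x] by (rule sums_cong[THEN iffD1, rotated]) (auto simp: power_0_left)
    then show "g 0 = x 0" using g(1)[of 0] r sums_unique2 by auto
    show "vector_analytic_on g (ball 0 r)"
      unfolding vector_analytic_on_def using g(2) by (metis at_within_open open_ball)
    fix w :: complex assume w: "w \<in> ball 0 r"
    have "(\<lambda>n. S (w ^ n *\<^sub>C x n)) sums S (g w)" by (rule S.sums[OF g(1)[OF w]])
    moreover have "(\<lambda>n. S (w ^ n *\<^sub>C x n)) sums (w *\<^sub>C g w)"
    proof -
      have "(\<lambda>n. w *\<^sub>C (w ^ n *\<^sub>C x n)) sums (w *\<^sub>C g w)"
        by (rule bounded_linear.sums[OF bounded_linear_scaleC g(1)[OF w]])
      then have "(\<lambda>n. S (w ^ Suc n *\<^sub>C x (Suc n))) sums (w *\<^sub>C g w)"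
        by (simp add: bounded_clinear_scaleC[OF S] xS scaleC_scaleC)
      from sums_Suc[OF this] show ?thesis by (simp add: x0)
    qed
    ultimately have "S (g w) = w *\<^sub>C g w" by (rule sums_unique2)
    then show "shift_op S w (g w) = 0" by (simp add: shift_op_def)
  qed
qed

text \<open>
  The operator maps its closed hyperrange onto itself, so by the open mapping theorem a kernel vector
  in the hyperrange starts a backward orbit of geometric growth. Its power series violates the single
  valued extension property, unless the vector is zero.
\<close>
lemma SVEP_imp_kernel_hyperrange_trivial:
  fixes T :: "'a::complex_banach \<Rightarrow> 'a" and z :: complex
  defines "S \<equiv> shift_op T z"
  assumes T: "bounded_clinear T" and sv: "SVEP_at T z"
    and M: "closed_csubspace M" "S ` M \<subseteq> M" and usF: "upper_semi_Fredholm_on M S"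
  shows "kernel_on M S \<inter> hyperrange_on M S \<subseteq> {0}"
proof
  fix x0 assume x0: "x0 \<in> kernel_on M S \<inter> hyperrange_on M S"
  have S: "bounded_clinear S" unfolding S_def by (rule bounded_clinear_shift_op[OF T])
  define R where "R = hyperrange_on M S"
  have R: "closed_csubspace R" "S ` R = R"
    using hyperrange_closed_csubspace[OF S M usF] hyperrange_image[OF S M usF] by (auto simp: R_def)
  obtain C where C: "C > 0" "\<And>w. w \<in> R \<Longrightarrow> \<exists>v\<in>R. S v = w \<and> norm v \<le> C * norm w"
    using closed_image_bounded_preimages[OF bounded_clinear_imp_bounded_linear[OF S], of R] R csubspace_imp_subspace by metis
  then obtain h where h: "\<And>w. w \<in> R \<Longrightarrow> h w \<in> R \<and> S (h w) = w \<and> norm (h w) \<le> C * norm w" by metis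
  define x where "x n = (h ^^ n) x0" for n
  have xR: "x n \<in> R" for n
    by (induction n) (use x0 h in \<open>auto simp: x_def R_def\<close>)
  have xS: "S (x (Suc n)) = x n" for n using h[OF xR[of n]] by (simp add: x_def)
  have bd: "norm (x n) \<le> C ^ n * norm x0" for n
  proof (induction n)
    case (Suc n)
    have "norm (x (Suc n)) \<le> C * norm (x n)" using h[OF xR[of n]] by (simp add: x_def)
    also have "\<dots> \<le> C * (C ^ n * norm x0)" using Suc C(1) by (intro mult_left_mono) auto
    finally show ?case by (simp add: mult.assoc)
  qed (simp add: x_def)
  have "S (x 0) = 0" using x0 by (simp add: x_def kernel_on_def)
  then obtain g r where g: "r > 0" "g 0 = x 0" "vector_analytic_on g (ball 0 r)"
    "\<And>w. w \<in> ball 0 r \<Longrightarrow> shift_op S w (g w) = 0"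
    using power_series_eigenvectors[of S x, OF S _ xS C(1) bd] by metis
  define f where "f \<zeta> = g (\<zeta> - z)" for \<zeta>
  have in_ball: "\<zeta> - z \<in> ball 0 r" if "\<zeta> \<in> ball z r" for \<zeta> using that by (simp add: dist_norm norm_minus_commute)
  have "vector_analytic_on f (ball z r)"
    unfolding vector_analytic_on_def
  proof
    fix \<zeta> assume "\<zeta> \<in> ball z r"
    then obtain d where "(g has_derivative (\<lambda>h. h *\<^sub>C d)) (at (\<zeta> - z))"
      using g(3) in_ball unfolding vector_analytic_on_def by blast
    moreover have "((\<lambda>\<zeta>. \<zeta> - z) has_derivative (\<lambda>h. h)) (at \<zeta>)"
      by (auto intro!: derivative_eq_intros)
    ultimately have "(f has_derivative (\<lambda>h. h *\<^sub>C d)) (at \<zeta>)"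
      unfolding f_def by (rule has_derivative_compose[rotated])
    then show "\<exists>d. (f has_derivative (\<lambda>h. h *\<^sub>C d)) (at \<zeta>)" by blast
  qed
  moreover have "shift_op T \<zeta> (f \<zeta>) = 0" if "\<zeta> \<in> ball z r" for \<zeta>
    using g(4)[OF in_ball[OF that]] by (simp add: S_def shift_op_shift_op f_def)
  ultimately have "f z = 0"
    using sv g(1) unfolding SVEP_at_def by (metis centre_in_ball connected_ball open_ball)
  then show "x0 \<in> {0}" using g(2) by (simp add: f_def x_def)
qed

section \<open>Quasi-nilpotent parts\<close>

lemma invertible_on_iff_bijective:
  fixes R :: "'a::complex_banach \<Rightarrow> 'a"
  assumes R: "bounded_clinear R" and D: "closed_csubspace D" "R ` D \<subseteq> D"
  shows "invertible_on D R \<longleftrightarrow> kernel_on D R \<subseteq> {0} \<and> D \<subseteq> R ` D"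
proof
  interpret R: bounded_linear R by (rule bounded_clinear_imp_bounded_linear[OF R])
  assume "invertible_on D R"
  then obtain G where G: "bounded_clinear_on D G" "\<And>x. x \<in> D \<Longrightarrow> G (R x) = x \<and> R (G x) = x"
    unfolding invertible_on_def by blast
  have GD: "G x \<in> D" if "x \<in> D" for x using G(1) that by (auto simp: bounded_clinear_on_def)
  have "x = 0" if "x \<in> kernel_on D R" for x
    using that G(2)[of x] G(2)[of 0] complex_vector.subspace_0[of D] D(1) by (auto simp: kernel_on_def R.zero)
  moreover have "x \<in> R ` D" if "x \<in> D" for x using G(2)[OF that] GD[OF that] by force
  ultimately show "kernel_on D R \<subseteq> {0} \<and> D \<subseteq> R ` D" by (simp add: subset_iff)
next
  interpret R: bounded_linear R by (rule bounded_clinear_imp_bounded_linear[OF R])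
  assume bij: "kernel_on D R \<subseteq> {0} \<and> D \<subseteq> R ` D"
  have RD: "R ` D = D" using bij D by blast
  obtain c where c: "c > 0" "\<And>x. x \<in> D \<Longrightarrow> c * norm x \<le> norm (R x)"
    using injective_closed_range_bounded_below[OF R D(1)] RD D(1) bij by (auto simp: bounded_below_on_def)
  have inj: "x = y" if "x \<in> D" "y \<in> D" "R x = R y" for x y
  proof -
    have "x - y \<in> kernel_on D R" using that D(1) by (auto simp: kernel_on_def R.diff intro: complex_vector.subspace_diff)
    then show ?thesis using bij by auto
  qed
  define G where "G = inv_into D R"
  have G: "G y \<in> D \<and> R (G y) = y" if "y \<in> D" for y
    using that inv_into_into[of y R D] f_inv_into_f[of y R D] by (simp add: G_def RD)
  have uniq: "G (R x) = x" if "x \<in> D" for x using G[of "R x"] that D(2) inj by blast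
  have "bounded_clinear_on D G"
    unfolding bounded_clinear_on_def
  proof (intro conjI ballI allI exI[of _ "1/c"])
    show "G ` D \<subseteq> D" using G by blast
    fix x y assume xy: "x \<in> D" "y \<in> D"
    then have "G x + G y \<in> D" using G D(1) by (simp add: complex_vector.subspace_add)
    from uniq[OF this] show "G (x + y) = G x + G y" using G xy by (simp add: R.add)
  next
    fix k x assume x: "x \<in> D"
    then have "k *\<^sub>C G x \<in> D" using G D(1) by (simp add: complex_vector.subspace_scale)
    from uniq[OF this] show "G (k *\<^sub>C x) = k *\<^sub>C G x" using G x by (simp add: bounded_clinear_scaleC[OF R])
  next
    fix x assume "x \<in> D"
    then show "norm (G x) \<le> norm x * (1/c)" using c(2)[of "G x"] G[of x] c(1) by (simp add: field_simps)
  qed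
  then show "invertible_on D R" unfolding invertible_on_def using G uniq by blast
qed

lemma shift_op_invariant:
  assumes "csubspace D" "S ` D \<subseteq> D" shows "shift_op S w ` D \<subseteq> D"
  using assms by (auto simp: shift_op_def intro!: complex_vector.subspace_diff complex_vector.subspace_scale)

text \<open>
  By the open mapping theorem the inverse of a bijection between closed subspaces is bounded, so quasi-nilpotency becomes a purely algebraic
  condition, which is easy to check on direct sums.
\<close>
lemma quasi_nilpotent_on_iff:
  fixes S :: "'a::complex_banach \<Rightarrow> 'a"
  assumes S: "bounded_clinear S" and D: "closed_csubspace D" "S ` D \<subseteq> D"
  shows "quasi_nilpotent_on D S \<longleftrightarrow>
    (\<forall>w. w \<noteq> 0 \<longrightarrow> kernel_on D (shift_op S w) \<subseteq> {0} \<and> D \<subseteq> shift_op S w ` D)"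
proof -
  have "invertible_on D (shift_op S w) \<longleftrightarrow> kernel_on D (shift_op S w) \<subseteq> {0} \<and> D \<subseteq> shift_op S w ` D" for w
    by (rule invertible_on_iff_bijective[OF bounded_clinear_shift_op[OF S] D(1) shift_op_invariant[OF conjunct1[OF D(1)] D(2)]])
  moreover have "quasi_nilpotent_on D S \<longleftrightarrow> (\<forall>w. w \<noteq> 0 \<longrightarrow> invertible_on D (shift_op S w))"
    by (auto simp: quasi_nilpotent_on_def spectrum_on_def)
  ultimately show ?thesis by simp
qed

lemma quasi_nilpotent_onD:
  fixes S :: "'a::complex_banach \<Rightarrow> 'a"
  assumes "bounded_clinear S" "closed_csubspace D" "S ` D \<subseteq> D" "quasi_nilpotent_on D S" "w \<noteq> 0"
  shows "kernel_on D (shift_op S w) \<subseteq> {0}" "D \<subseteq> shift_op S w ` D"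
  using iffD1[OF quasi_nilpotent_on_iff[OF assms(1-3)] assms(4)] assms(5) by simp_all

text \<open>
  For surjectivity of \<open>S - w\<close> at a vector \<open>x\<close> that \<open>S ^^ Suc k\<close> annihilates, the induction on \<open>k\<close> solves
  \<open>(S - w) y = S x\<close>; then \<open>(y - x) / w\<close> is mapped to \<open>x\<close>.
\<close>
lemma nilpotent_imp_quasi_nilpotent_on:
  fixes S :: "'a::complex_banach \<Rightarrow> 'a"
  assumes S: "bounded_clinear S" and D: "closed_csubspace D" "S ` D \<subseteq> D" and nil: "\<forall>y\<in>D. (S ^^ n) y = 0"
  shows "quasi_nilpotent_on D S"
  unfolding quasi_nilpotent_on_iff[OF S D]
proof (intro allI impI conjI subsetI)
  interpret S: bounded_linear S by (rule bounded_clinear_imp_bounded_linear[OF S])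
  fix w :: complex assume w: "w \<noteq> 0"
  show "x \<in> {0}" if "x \<in> kernel_on D (shift_op S w)" for x
  proof -
    have x: "x \<in> D" "S x = w *\<^sub>C x" using that by (auto simp: kernel_on_def shift_op_def)
    have "(S ^^ k) x = w ^ k *\<^sub>C x" for k
      by (induction k) (simp_all add: bounded_clinear_scaleC[OF S] x(2) scaleC_scaleC mult.commute)
    then show ?thesis using nil x(1) w by (metis complex_vector.scale_eq_0_iff power_not_zero singletonI)
  qed
  have "\<exists>y\<in>D. shift_op S w y = x" if "x \<in> D" "(S ^^ k) x = 0" for k x
    using that
  proof (induction k arbitrary: x)
    case 0
    then show ?case by (intro bexI[of _ 0]) (auto simp: shift_op_def S.zero)
  next
    case (Suc k)
    have "S x \<in> D" "(S ^^ k) (S x) = 0" using Suc.prems D(2) by (auto simp: funpow_swap1)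
    then obtain y where y: "y \<in> D" "shift_op S w y = S x" using Suc.IH by blast
    have Sy: "S y = S x + w *\<^sub>C y" using y(2) by (simp add: shift_op_def algebra_simps)
    have "shift_op S w ((1/w) *\<^sub>C (y - x)) = x"
      using w by (simp add: shift_op_def bounded_clinear_scaleC[OF S] S.diff Sy complex_vector.scale_right_diff_distrib scaleC_add_right scaleC_scaleC)
    moreover have "(1/w) *\<^sub>C (y - x) \<in> D"
      using D(1) y(1) Suc.prems(1) by (intro complex_vector.subspace_scale complex_vector.subspace_diff) auto
    ultimately show ?case by blast
  qed
  then show "x \<in> shift_op S w ` D" if "x \<in> D" for x using nil that by blast
qed

text \<open>
  Each summand is invariant, so the two components of the image lie in complementary subspaces.
\<close>
lemma invariant_splitting_shift_op_kernel:
  assumes S: "bounded_clinear S" and sp: "invariant_splitting S M A B" and x: "a \<in> A" "b \<in> B" and z: "shift_op S w (a + b) = 0"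
  shows "shift_op S w a = 0" "shift_op S w b = 0"
proof -
  interpret R: bounded_linear "shift_op S w" by (rule bounded_clinear_imp_bounded_linear[OF bounded_clinear_shift_op[OF S]])
  have A: "csubspace A" "S ` A \<subseteq> A" and B: "csubspace B" "S ` B \<subseteq> B" and AB: "A \<inter> B = {0}" using sp by (auto simp: invariant_splitting_def)
  have a: "shift_op S w a \<in> A" using shift_op_invariant[OF A] x by blast
  have b: "shift_op S w b \<in> B" using shift_op_invariant[OF B] x by blast
  have "shift_op S w a = - shift_op S w b" using z by (simp add: R.add eq_neg_iff_add_eq_0)
  then have "shift_op S w a \<in> A \<inter> B" using a b complex_vector.subspace_neg[OF B(1)] by simp
  then show "shift_op S w a = 0" using AB by blast
  then show "shift_op S w b = 0" using z by (simp add: R.add)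
qed

lemma quasi_nilpotent_on_invariant_splitting:
  fixes S :: "'a::complex_banach \<Rightarrow> 'a"
  assumes S: "bounded_clinear S" and D: "closed_csubspace D" "S ` D \<subseteq> D" and sp: "invariant_splitting S D A B"
    and qA: "quasi_nilpotent_on A S" and qB: "quasi_nilpotent_on B S"
  shows "quasi_nilpotent_on D S"
  unfolding quasi_nilpotent_on_iff[OF S D]
proof (intro allI impI conjI subsetI)
  fix w :: complex assume w: "w \<noteq> 0"
  interpret R: bounded_linear "shift_op S w" by (rule bounded_clinear_imp_bounded_linear[OF bounded_clinear_shift_op[OF S]])
  have A: "closed_csubspace A" "S ` A \<subseteq> A" and B: "closed_csubspace B" "S ` B \<subseteq> B" and Ds: "D = subspace_sum A B"
    using sp by (auto simp: invariant_splitting_def)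
  have A': "kernel_on A (shift_op S w) \<subseteq> {0}" "A \<subseteq> shift_op S w ` A"
    by (fact quasi_nilpotent_onD[OF S A qA w])+
  have B': "kernel_on B (shift_op S w) \<subseteq> {0}" "B \<subseteq> shift_op S w ` B"
    by (fact quasi_nilpotent_onD[OF S B qB w])+
  {
    fix x assume "x \<in> kernel_on D (shift_op S w)"
    then obtain a b where x: "x = a + b" "a \<in> A" "b \<in> B" "shift_op S w (a + b) = 0" unfolding Ds kernel_on_def by blast
    have "a = 0" "b = 0" using invariant_splitting_shift_op_kernel[OF S sp x(2-4)] A' B' x by (auto simp: kernel_on_def)
    then show "x \<in> {0}" using x by simp
  }
  {
    fix x assume "x \<in> D"
    then obtain a b where x: "x = a + b" "a \<in> A" "b \<in> B" unfolding Ds by blast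
    obtain a' where a': "a = shift_op S w a'" "a' \<in> A" using subsetD[OF A'(2) x(2)] by (rule imageE)
    obtain b' where b': "b = shift_op S w b'" "b' \<in> B" using subsetD[OF B'(2) x(3)] by (rule imageE)
    have "a' + b' \<in> D" unfolding Ds using a'(2) b'(2) by blast
    moreover have "x = shift_op S w (a' + b')" by (simp add: x(1) a'(1) b'(1) R.add)
    ultimately show "x \<in> shift_op S w ` D" by blast
  }
qed

section \<open>Pseudo upper B-Fredholm and generalized Drazin bounded below operators\<close>

text \<open>
  Addition is a continuous bijection from \<open>M \<times> N\<close> onto the whole space. The open mapping theorem makes
  its inverse, and with it the projection along \<open>N\<close>, continuous.
\<close>
lemma invariant_splitting_bounded_projection:
  fixes S :: "'a::complex_banach \<Rightarrow> 'a"
  assumes sp: "invariant_splitting S UNIV M N"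
  obtains P where "bounded_linear P" "\<And>x y. x \<in> M \<Longrightarrow> y \<in> N \<Longrightarrow> P (x + y) = x"
proof -
  have M: "csubspace M" "closed M" and N: "csubspace N" "closed N" and MN: "M \<inter> N = {0}" and U: "subspace_sum M N = UNIV"
    using sp by (auto simp: invariant_splitting_def)
  note rM = csubspace_imp_subspace[OF M(1)] and rN = csubspace_imp_subspace[OF N(1)]
  define P where "P w = (SOME x. x \<in> M \<and> w - x \<in> N)" for w
  have P: "P w \<in> M \<and> w - P w \<in> N" for w
  proof -
    have "w \<in> subspace_sum M N" using U by simp
    then obtain x y where "w = x + y" "x \<in> M" "y \<in> N" by blast
    then have "x \<in> M \<and> w - x \<in> N" by simp
    then show ?thesis unfolding P_def by (rule someI)
  qed
  have Pu: "P w = x" if "x \<in> M" "w - x \<in> N" for w x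
  proof -
    have "P w - x \<in> M" using P that(1) rM by (simp add: subspace_diff)
    moreover have "P w - x \<in> N" using subspace_diff[OF rN that(2) conjunct2[OF P[of w]]] by simp
    ultimately show ?thesis using MN by (metis IntI empty_iff insert_iff right_minus_eq)
  qed
  define f :: "'a \<times> 'a \<Rightarrow> 'a" where "f p = fst p + snd p" for p
  have f: "bounded_linear f" unfolding f_def by (intro bounded_linear_add bounded_linear_fst bounded_linear_snd)
  have fU: "f ` (M \<times> N) = UNIV"
  proof -
    have "w \<in> f ` (M \<times> N)" for w using P[of w] by (intro image_eqI[of _ _ "(P w, w - P w)"]) (auto simp: f_def)
    then show ?thesis by blast
  qed
  have "subspace (M \<times> N)" using rM rN by (rule subspace_Times)
  moreover have "closed (M \<times> N)" using M N by (intro closed_Times)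
  ultimately obtain C where C: "C > 0" "\<And>w. \<exists>v\<in>M \<times> N. f v = w \<and> norm v \<le> C * norm w"
    using closed_image_bounded_preimages[OF f, of "M \<times> N"] fU by (metis UNIV_I closed_UNIV)
  have "bounded_linear P"
  proof (rule bounded_linear_intro[of _ C])
    fix x y :: 'a and r :: real
    have "x + y - (P x + P y) \<in> N"
      using subspace_add[OF rN conjunct2[OF P[of x]] conjunct2[OF P[of y]]] by (simp add: algebra_simps)
    then show "P (x + y) = P x + P y"
      using P[of x] P[of y] rM by (intro Pu) (auto simp: subspace_add)
    have "r *\<^sub>R x - r *\<^sub>R P x \<in> N"
      using subspace_scale[OF rN conjunct2[OF P[of x]], of r] by (simp add: scaleR_diff_right)
    then show "P (r *\<^sub>R x) = r *\<^sub>R P x"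
      using P[of x] rM by (intro Pu) (auto simp: subspace_scale)
    obtain a b where ab: "a \<in> M" "b \<in> N" "a + b = x" "norm (a, b) \<le> C * norm x" using C(2)[of x] by (auto simp: f_def)
    then have "P x = a" by (intro Pu) auto
    then show "norm (P x) \<le> norm x * C" using ab(4) norm_fst_le[of a b] by (simp add: mult.commute)
  qed
  moreover have "P (x + y) = x" if "x \<in> M" "y \<in> N" for x y using that by (intro Pu) auto
  ultimately show ?thesis by (rule that)
qed

text \<open>
  A small nonzero shift stays upper semi-Fredholm on \<open>M\<close> and becomes bijective on \<open>N\<close>. Its kernel is
  therefore inside \<open>M\<close>, and its range is the preimage of \<open>shift_op S w ` M\<close> under the projection onto
  \<open>M\<close> along \<open>N\<close>.
\<close>
lemma pseudo_upper_B_Fredholm_punctured: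
  fixes S :: "'a::complex_banach \<Rightarrow> 'a"
  assumes S: "bounded_clinear S" and pB: "pseudo_upper_B_Fredholm S"
  obtains e where "e > 0" "\<And>w. w \<noteq> 0 \<Longrightarrow> cmod w < e \<Longrightarrow> upper_semi_Fredholm (shift_op S w)"
proof -
  obtain M N where MN: "(M, N) \<in> Red S" "upper_semi_Fredholm_on M S" "quasi_nilpotent_on N S"
    using pB unfolding pseudo_upper_B_Fredholm_def by blast
  have sp: "invariant_splitting S UNIV M N" using MN(1) by (simp add: invariant_splitting_UNIV_iff_Red)
  have M: "closed_csubspace M" "S ` M \<subseteq> M" and N: "closed_csubspace N" "S ` N \<subseteq> N" and U: "subspace_sum M N = UNIV"
    using sp by (auto simp: invariant_splitting_def)
  obtain e where e: "e > 0" "\<And>w. cmod w < e \<Longrightarrow> upper_semi_Fredholm_on M (shift_op S w)"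
    using upper_semi_Fredholm_on_small_shift[OF S M(1) MN(2)] by blast
  obtain P where P: "bounded_linear P" "\<And>x y. x \<in> M \<Longrightarrow> y \<in> N \<Longrightarrow> P (x + y) = x"
    using invariant_splitting_bounded_projection[OF sp] by blast
  have dec: "\<exists>x y. v = x + y \<and> x \<in> M \<and> y \<in> N" for v
  proof -
    have "v \<in> subspace_sum M N" using U by simp
    then show ?thesis by blast
  qed
  have "upper_semi_Fredholm (shift_op S w)" if w: "w \<noteq> 0" "cmod w < e" for w
  proof -
    interpret R: bounded_linear "shift_op S w" by (rule bounded_clinear_imp_bounded_linear[OF bounded_clinear_shift_op[OF S]])
    have Nw: "kernel_on N (shift_op S w) \<subseteq> {0}" "N \<subseteq> shift_op S w ` N"
      by (fact quasi_nilpotent_onD[OF S N MN(3) w(1)])+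
    have RM: "shift_op S w x \<in> M" if "x \<in> M" for x using shift_op_invariant[OF conjunct1[OF M(1)] M(2)] that by blast
    have RN: "shift_op S w x \<in> N" if "x \<in> N" for x using shift_op_invariant[OF conjunct1[OF N(1)] N(2)] that by blast
    have "kernel_on UNIV (shift_op S w) \<subseteq> kernel_on M (shift_op S w)"
    proof
      fix x assume x: "x \<in> kernel_on UNIV (shift_op S w)"
      obtain a b where ab: "x = a + b" "a \<in> M" "b \<in> N" using dec by blast
      then have "shift_op S w (a + b) = 0" using x by (simp add: kernel_on_def)
      from invariant_splitting_shift_op_kernel[OF S sp ab(2,3) this] show "x \<in> kernel_on M (shift_op S w)"
        using Nw(1) ab by (auto simp: kernel_on_def)
    qed
    then have "finite_cdim (kernel_on UNIV (shift_op S w))"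
      using e(2)[OF w(2)] unfolding upper_semi_Fredholm_on_def by (blast intro: finite_cdim_subset)
    moreover have "range (shift_op S w) = P -` (shift_op S w ` M)"
    proof (intro equalityI subsetI)
      fix v assume "v \<in> range (shift_op S w)"
      then obtain x where x: "v = shift_op S w x" by blast
      obtain a b where ab: "x = a + b" "a \<in> M" "b \<in> N" using dec by blast
      then have "P v = shift_op S w a" using P(2)[OF RM[OF ab(2)] RN[OF ab(3)]] by (simp add: x R.add)
      then show "v \<in> P -` (shift_op S w ` M)" using ab by simp
    next
      fix v assume v: "v \<in> P -` (shift_op S w ` M)"
      obtain a b where ab: "v = a + b" "a \<in> M" "b \<in> N" using dec by blast
      then obtain a' where a': "a = shift_op S w a'" using v P(2)[OF ab(2,3)] by auto
      obtain b' where b': "b = shift_op S w b'" using Nw(2) ab(3) by blast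
      have "v = shift_op S w (a' + b')" using ab(1) a' b' by (simp add: R.add)
      then show "v \<in> range (shift_op S w)" by blast
    qed
    moreover have "closed (P -` (shift_op S w ` M))"
      using e(2)[OF w(2)] unfolding upper_semi_Fredholm_on_def
      by (intro closed_vimage linear_continuous_on P(1)) auto
    ultimately show ?thesis by (simp add: upper_semi_Fredholm_def upper_semi_Fredholm_on_def)
  qed
  then show ?thesis using e(1) that by blast
qed

lemma upper_semi_Fredholm_imp_pseudo_upper_B_Fredholm:
  fixes S :: "'a::complex_banach \<Rightarrow> 'a"
  assumes S: "bounded_clinear S" and usF: "upper_semi_Fredholm S"
  shows "pseudo_upper_B_Fredholm S"
proof -
  interpret S: bounded_linear S by (rule bounded_clinear_imp_bounded_linear[OF S])
  have "(UNIV, {0}) \<in> Red S"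
    by (auto simp: Red_def complex_vector.subspace_UNIV complex_vector.subspace_single_0 S.zero)
  moreover have "quasi_nilpotent_on {0} S"
    by (rule nilpotent_imp_quasi_nilpotent_on[OF S, of _ 0]) (auto simp: complex_vector.subspace_single_0 S.zero)
  ultimately show ?thesis
    using usF unfolding pseudo_upper_B_Fredholm_def upper_semi_Fredholm_def by blast
qed

lemma gen_Drazin_bounded_below_imp_pseudo_upper_B_Fredholm:
  fixes S :: "'a::complex_banach \<Rightarrow> 'a"
  assumes S: "bounded_clinear S" and gD: "gen_Drazin_bounded_below S"
  shows "pseudo_upper_B_Fredholm S"
proof -
  obtain M N where MN: "(M, N) \<in> Red S" "bounded_below_on M S" "quasi_nilpotent_on N S"
    using gD unfolding gen_Drazin_bounded_below_def by blast
  obtain c where c: "c > 0" "\<And>x. x \<in> M \<Longrightarrow> c * norm x \<le> norm (S x)" using MN(2) by (auto simp: bounded_below_on_def)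
  have "kernel_on M S \<subseteq> cspan {}" using c by (auto simp: kernel_on_def) (metis mult_le_0_iff norm_le_zero_iff norm_zero not_le)
  moreover have "closed (S ` M)" using MN(1,2) by (intro bounded_below_closed_image S) (auto simp: Red_def)
  ultimately have "upper_semi_Fredholm_on M S"
    unfolding upper_semi_Fredholm_on_def finite_cdim_def by blast
  then show ?thesis using MN unfolding pseudo_upper_B_Fredholm_def by blast
qed

text \<open>
  A shift by less than the lower bound on \<open>M\<close> stays injective there, and every nonzero shift is
  injective on \<open>N\<close>; so the operator is injective on a punctured neighbourhood.
\<close>
lemma gen_Drazin_bounded_below_imp_SVEP_at:
  fixes T :: "'a::complex_banach \<Rightarrow> 'a"
  assumes T: "bounded_clinear T" and gD: "gen_Drazin_bounded_below (shift_op T z)"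
  shows "SVEP_at T z"
proof -
  define S where "S = shift_op T z"
  have S: "bounded_clinear S" unfolding S_def by (rule bounded_clinear_shift_op[OF T])
  obtain M N where MN: "(M, N) \<in> Red S" "bounded_below_on M S" "quasi_nilpotent_on N S"
    using gD unfolding gen_Drazin_bounded_below_def S_def by blast
  have sp: "invariant_splitting S UNIV M N" using MN(1) by (simp add: invariant_splitting_UNIV_iff_Red)
  have N: "closed_csubspace N" "S ` N \<subseteq> N" and U: "subspace_sum M N = UNIV" using sp by (auto simp: invariant_splitting_def)
  obtain c where c: "c > 0" "\<And>x. x \<in> M \<Longrightarrow> c * norm x \<le> norm (S x)" using MN(2) by (auto simp: bounded_below_on_def)
  show ?thesis
  proof (rule SVEP_at_of_punctured_injective[OF c(1)])
    fix w x assume w: "0 < cmod w" "cmod w < c" and x: "shift_op (shift_op T z) w x = 0"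
    have "x \<in> subspace_sum M N" using U by simp
    then obtain a b where ab: "x = a + b" "a \<in> M" "b \<in> N" by blast
    then have "shift_op S w (a + b) = 0" using x by (simp add: S_def)
    from invariant_splitting_shift_op_kernel[OF S sp ab(2,3) this] have a: "S a = w *\<^sub>C a" and b: "shift_op S w b = 0"
      by (auto simp: shift_op_def)
    have "kernel_on N (shift_op S w) \<subseteq> {0}" by (rule quasi_nilpotent_onD(1)[OF S N MN(3)]) (use w in auto)
    then have "b = 0" using b ab(3) by (auto simp: kernel_on_def)
    moreover have "a = 0"
    proof (rule ccontr)
      assume "a \<noteq> 0"
      then have "cmod w * norm a < c * norm a" using w by simp
      then show False using c(2)[OF ab(2)] a by (simp add: norm_scaleC)
    qed
    ultimately show "x = 0" using ab(1) by simp
  qed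
qed

text \<open>
  The extension property removes kernel vectors from the hyperrange of the semi-Fredholm part, which
  then invariant_splitting into a part bounded below and a nilpotent part. The latter joins the quasi-nilpotent
  summand.
\<close>
lemma pseudo_upper_B_Fredholm_SVEP_imp_gen_Drazin_bounded_below:
  fixes T :: "'a::complex_banach \<Rightarrow> 'a"
  assumes T: "bounded_clinear T" and pB: "pseudo_upper_B_Fredholm (shift_op T z)" and sv: "SVEP_at T z"
  shows "gen_Drazin_bounded_below (shift_op T z)"
proof -
  define S where "S = shift_op T z"
  have S: "bounded_clinear S" unfolding S_def by (rule bounded_clinear_shift_op[OF T])
  obtain M N where MN: "(M, N) \<in> Red S" "upper_semi_Fredholm_on M S" "quasi_nilpotent_on N S"
    using pB unfolding pseudo_upper_B_Fredholm_def S_def by blast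
  have sp: "invariant_splitting S UNIV M N" using MN(1) by (simp add: invariant_splitting_UNIV_iff_Red)
  have M: "closed_csubspace M" "S ` M \<subseteq> M" using sp by (auto simp: invariant_splitting_def)
  have "kernel_on M S \<inter> hyperrange_on M S \<subseteq> {0}"
    using SVEP_imp_kernel_hyperrange_trivial[OF T sv] M MN(2) unfolding S_def by blast
  then obtain A B n where AB: "invariant_splitting S M A B" "bounded_below_on A S" "finite_cdim B" "\<forall>y\<in>B. (S ^^ n) y = 0"
    using upper_semi_Fredholm_nilpotent_splitting[OF S M MN(2)] by blast
  have B: "closed_csubspace B" "S ` B \<subseteq> B" using AB(1) by (auto simp: invariant_splitting_def)
  define D where "D = subspace_sum B N"
  have spD: "invariant_splitting S UNIV A D" "invariant_splitting S D B N" using invariant_splitting_assoc[OF S sp AB(1,3)] by (auto simp: D_def)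
  have "quasi_nilpotent_on D S"
  proof (rule quasi_nilpotent_on_invariant_splitting[OF S _ _ spD(2) nilpotent_imp_quasi_nilpotent_on[OF S B AB(4)] MN(3)])
    show "closed_csubspace D" "S ` D \<subseteq> D" using spD(1) unfolding invariant_splitting_def by blast+
  qed
  then show ?thesis
    using spD(1) AB(2) unfolding gen_Drazin_bounded_below_def invariant_splitting_UNIV_iff_Red S_def by blast
qed

text \<open>
  If the kernels of \<open>S ^^ p\<close> and \<open>S ^^ (p + 1)\<close> agree, a kernel vector of the form \<open>(S ^^ p) u\<close> is zero. So
  finite ascent also forces the kernel to meet the hyperrange trivially, and the nilpotent splitting
  exhibits the operator as generalized Drazin bounded below.
\<close>
lemma upper_semi_Browder_imp_SVEP_at:
  fixes T :: "'a::complex_banach \<Rightarrow> 'a"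
  assumes T: "bounded_clinear T" and uB: "upper_semi_Browder (shift_op T z)"
  shows "SVEP_at T z"
proof -
  define S where "S = shift_op T z"
  have S: "bounded_clinear S" unfolding S_def by (rule bounded_clinear_shift_op[OF T])
  have usF: "upper_semi_Fredholm_on UNIV S" and asc: "ascent S < \<infinity>"
    using uB unfolding upper_semi_Browder_def upper_semi_Fredholm_def S_def by blast+
  have "{p. kernel_on UNIV (S ^^ p) = kernel_on UNIV (S ^^ (p + 1))} \<noteq> {}"
  proof
    assume "{p. kernel_on UNIV (S ^^ p) = kernel_on UNIV (S ^^ (p + 1))} = {}"
    then have "ascent S = Inf {}" unfolding ascent_def by (simp only: image_empty)
    then show False using asc by (simp add: Inf_enat_def)
  qed
  then obtain p where p: "kernel_on UNIV (S ^^ p) = kernel_on UNIV (S ^^ (p + 1))" by blast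
  have "kernel_on UNIV S \<inter> hyperrange_on UNIV S \<subseteq> {0}"
  proof
    fix x assume x: "x \<in> kernel_on UNIV S \<inter> hyperrange_on UNIV S"
    then obtain u where u: "x = (S ^^ p) u" unfolding hyperrange_on_def by blast
    have "u \<in> kernel_on UNIV (S ^^ (p + 1))" using x u by (simp add: kernel_on_def)
    then have "u \<in> kernel_on UNIV (S ^^ p)" using p by simp
    then show "x \<in> {0}" using u by (simp add: kernel_on_def)
  qed
  then obtain A B n where AB: "invariant_splitting S UNIV A B" "bounded_below_on A S" "\<forall>y\<in>B. (S ^^ n) y = 0"
    using upper_semi_Fredholm_nilpotent_splitting[OF S _ _ usF] complex_vector.subspace_UNIV by blast
  have B: "closed_csubspace B" "S ` B \<subseteq> B" using AB(1) by (auto simp: invariant_splitting_def)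
  have "gen_Drazin_bounded_below S"
    using AB(1,2) nilpotent_imp_quasi_nilpotent_on[OF S B AB(3)]
    unfolding gen_Drazin_bounded_below_def invariant_splitting_UNIV_iff_Red by blast
  then show ?thesis using gen_Drazin_bounded_below_imp_SVEP_at[OF T] by (simp add: S_def)
qed

text \<open>
  In the splitting into a part bounded below and a part with \<open>S ^^ n = 0\<close>, only the second one
  contributes to the kernels of powers, so the ascent is at most \<open>n\<close>.
\<close>
lemma upper_semi_Fredholm_SVEP_imp_upper_semi_Browder:
  fixes T :: "'a::complex_banach \<Rightarrow> 'a"
  assumes T: "bounded_clinear T" and usF: "upper_semi_Fredholm (shift_op T z)" and sv: "SVEP_at T z"
  shows "upper_semi_Browder (shift_op T z)"
proof -
  define S where "S = shift_op T z"
  have S: "bounded_clinear S" unfolding S_def by (rule bounded_clinear_shift_op[OF T])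
  have pow: "bounded_linear (S ^^ k)" for k by (intro bounded_clinear_imp_bounded_linear bounded_clinear_funpow S)
  have U: "closed_csubspace (UNIV :: 'a set)" "S ` UNIV \<subseteq> UNIV" by (auto simp: complex_vector.subspace_UNIV)
  have usF': "upper_semi_Fredholm_on UNIV S" using usF by (simp add: upper_semi_Fredholm_def S_def)
  have "kernel_on UNIV S \<inter> hyperrange_on UNIV S \<subseteq> {0}"
    using SVEP_imp_kernel_hyperrange_trivial[OF T sv] U usF' unfolding S_def by blast
  then obtain A B n where AB: "invariant_splitting S UNIV A B" "bounded_below_on A S" "\<forall>y\<in>B. (S ^^ n) y = 0"
    using upper_semi_Fredholm_nilpotent_splitting[OF S U usF'] by blast
  have A: "S ` A \<subseteq> A" and sum: "subspace_sum A B = UNIV" using AB(1) by (auto simp: invariant_splitting_def)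
  obtain c where c: "c > 0" "\<And>x. x \<in> A \<Longrightarrow> c * norm x \<le> norm (S x)" using AB(2) by (auto simp: bounded_below_on_def)
  have inj: "a = 0" if "a \<in> A" "(S ^^ k) a = 0" for a k
    using that
  proof (induction k arbitrary: a)
    case (Suc k)
    have "S a = 0" by (rule Suc.IH) (use Suc.prems A in \<open>auto simp: funpow_swap1\<close>)
    then show ?case using c(1) c(2)[OF Suc.prems(1)] by (simp add: mult_le_0_iff)
  qed simp
  have "kernel_on UNIV (S ^^ n) = kernel_on UNIV (S ^^ (n + 1))"
  proof (intro equalityI subsetI)
    fix x assume "x \<in> kernel_on UNIV (S ^^ n)"
    then show "x \<in> kernel_on UNIV (S ^^ (n + 1))"
      using bounded_linear.linear[OF pow[of 1]] by (simp add: kernel_on_def linear_0)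
  next
    fix x assume x: "x \<in> kernel_on UNIV (S ^^ (n + 1))"
    have "x \<in> subspace_sum A B" using sum by simp
    then obtain a b where ab: "x = a + b" "a \<in> A" "b \<in> B" by blast
    have b0: "(S ^^ n) b = 0" "(S ^^ (n + 1)) b = 0"
      using AB(3) ab(3) bounded_linear.linear[OF pow[of 1]] by (auto simp: linear_0)
    have "(S ^^ (n + 1)) a = 0"
      using x b0(2) linear_add[OF bounded_linear.linear[OF pow], of "n + 1" a b] by (simp add: ab(1) kernel_on_def)
    then have "a = 0" using ab(2) inj by blast
    then show "x \<in> kernel_on UNIV (S ^^ n)" using ab(1) b0(1) by (simp add: kernel_on_def)
  qed
  then have "ascent S \<le> enat n" unfolding ascent_def by (intro Inf_lower) blast
  then have "ascent S < \<infinity>" by (rule order.strict_trans1) simp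
  then show ?thesis using usF by (simp add: upper_semi_Browder_def S_def)
qed

text \<open>
  The extension property at one point of a connected open set controls solutions on the whole set.
  Hence it passes to \<open>z\<close> from any sequence of points that converges to \<open>z\<close>; this is how the second
  condition, applied at small nonzero shifts of a pseudo upper B-Fredholm operator, yields the third.
\<close>
theorem theorem2p4:
  fixes T :: "'a::complex_banach \<Rightarrow> 'a"
  assumes "bounded_clinear T"
  shows "(sigma_uf T = sigma_uB T \<longleftrightarrow> (\<forall>z. z \<notin> sigma_uf T \<longrightarrow> SVEP_at T z)) \<and>
         ((\<forall>z. z \<notin> sigma_uf T \<longrightarrow> SVEP_at T z) \<longleftrightarrow> (\<forall>z. z \<notin> sigma_puBF T \<longrightarrow> SVEP_at T z)) \<and>
         ((\<forall>z. z \<notin> sigma_puBF T \<longrightarrow> SVEP_at T z) \<longleftrightarrow> sigma_gDM T = sigma_puBF T)"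
proof (intro conjI)
  note T = assms
  have sub: "sigma_uf T \<subseteq> sigma_uB T" by (auto simp: sigma_uf_def sigma_uB_def upper_semi_Browder_def)
  show "sigma_uf T = sigma_uB T \<longleftrightarrow> (\<forall>z. z \<notin> sigma_uf T \<longrightarrow> SVEP_at T z)"
  proof
    assume eq: "sigma_uf T = sigma_uB T"
    show "\<forall>z. z \<notin> sigma_uf T \<longrightarrow> SVEP_at T z"
      unfolding eq using upper_semi_Browder_imp_SVEP_at[OF T] by (simp add: sigma_uB_def)
  next
    assume "\<forall>z. z \<notin> sigma_uf T \<longrightarrow> SVEP_at T z"
    then have "sigma_uB T \<subseteq> sigma_uf T"
      using upper_semi_Fredholm_SVEP_imp_upper_semi_Browder[OF T] by (auto simp: sigma_uB_def sigma_uf_def)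
    with sub show "sigma_uf T = sigma_uB T" by blast
  qed
  show "(\<forall>z. z \<notin> sigma_uf T \<longrightarrow> SVEP_at T z) \<longleftrightarrow> (\<forall>z. z \<notin> sigma_puBF T \<longrightarrow> SVEP_at T z)"
  proof
    assume sv: "\<forall>z. z \<notin> sigma_uf T \<longrightarrow> SVEP_at T z"
    show "\<forall>z. z \<notin> sigma_puBF T \<longrightarrow> SVEP_at T z"
    proof (intro allI impI)
      fix z assume "z \<notin> sigma_puBF T"
      then have "pseudo_upper_B_Fredholm (shift_op T z)" by (simp add: sigma_puBF_def)
      then obtain e where e: "e > 0"
        "\<And>w. w \<noteq> 0 \<Longrightarrow> cmod w < e \<Longrightarrow> upper_semi_Fredholm (shift_op (shift_op T z) w)"
        using pseudo_upper_B_Fredholm_punctured[OF bounded_clinear_shift_op[OF T]] by metis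
      show "SVEP_at T z"
        unfolding SVEP_at_def
      proof (intro allI impI)
        fix U f assume U: "open U \<and> connected U \<and> z \<in> U"
          and f: "vector_analytic_on f U \<and> (\<forall>z\<in>U. shift_op T z (f z) = 0)"
        obtain d where d: "d > 0" "ball z d \<subseteq> U" using U open_contains_ball by blast
        define w where "w = complex_of_real (min d e / 2)"
        have w: "w \<noteq> 0" "cmod w < e" "cmod w < d" using d(1) e(1) by (auto simp: w_def)
        have "z + w \<notin> sigma_uf T"
          using e(2)[OF w(1,2)] by (simp add: sigma_uf_def shift_op_shift_op)
        then have "SVEP_at T (z + w)" using sv by blast
        moreover have "z + w \<in> U" using d(2) w(3) by (auto simp: dist_norm subset_iff)
        ultimately show "\<forall>z\<in>U. f z = 0" using U f unfolding SVEP_at_def by blast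
      qed
    qed
  next
    assume "\<forall>z. z \<notin> sigma_puBF T \<longrightarrow> SVEP_at T z"
    then show "\<forall>z. z \<notin> sigma_uf T \<longrightarrow> SVEP_at T z"
      using upper_semi_Fredholm_imp_pseudo_upper_B_Fredholm[OF bounded_clinear_shift_op[OF T]]
      by (auto simp: sigma_uf_def sigma_puBF_def)
  qed
  show "(\<forall>z. z \<notin> sigma_puBF T \<longrightarrow> SVEP_at T z) \<longleftrightarrow> sigma_gDM T = sigma_puBF T"
  proof
    assume sv: "\<forall>z. z \<notin> sigma_puBF T \<longrightarrow> SVEP_at T z"
    show "sigma_gDM T = sigma_puBF T"
      using sv gen_Drazin_bounded_below_imp_pseudo_upper_B_Fredholm[OF bounded_clinear_shift_op[OF T]]
        pseudo_upper_B_Fredholm_SVEP_imp_gen_Drazin_bounded_below[OF T]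
      by (auto simp: sigma_gDM_def sigma_puBF_def)
  next
    assume "sigma_gDM T = sigma_puBF T"
    then show "\<forall>z. z \<notin> sigma_puBF T \<longrightarrow> SVEP_at T z"
      using gen_Drazin_bounded_below_imp_SVEP_at[OF T] by (auto simp: sigma_gDM_def)
  qed
qed

end
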